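(* Let $x:M^n\rightarrow\mathbb{R}^{n+1}$, with $n\geq 3$, be a hypersurface without umbilic points, having distinct, nonvanishing principal curvatures. If $x$ is both L-isotropic and L-isoparametric, then all eigenvalues of the Laguerre tensor $\mathbb{L}$ are equal and zero, i.e., $\lambda=0$.
   Context: Let $x:M^n\to\mathbb{R}^{n+1}$ be an oriented immersed hypersurface with unit normal $\xi:M^n\to\mathbb{S}^n$, without umbilic points and with nonvanishing principal curvatures. Let $\{e_1,\dots,e_n\}$ be a local frame of unit principal vectors, orthonormal for $dx\cdot dx$, with $e_i(\xi)=-k_ie_i(x)$, $k_i\neq 0$ the principal curvatures. Put $r_i=1/k_i$ (radii of curvature), $r=\frac1n\sum_i r_i$ (mean radius of curvature), $\rho=\sqrt{\sum_i(r-r_i)^2}>0$. Let $III=d\xi\cdot d\xi$ be the third fundamental form. The Laguerre metric is $g=\rho^2\,III$; the vector fields $E_i=\rho^{-1}r_ie_i$ form a $g$-orthonormal frame, with dual coframe $\omega_i$. Laguerre invariants, in this frame: - Laguerre second fundamental form $\mathbb{B}=\sum_{ij}B_{ij}\omega_i\otimes\omega_j$, $B_{ij}=b_i\delta_{ij}$, where $b_i=\rho^{-1}(r-r_i)$ are the Laguerre principal curvatures; - Laguerre form $\mathbb{C}=\sum_iC_i\omega_i$, $C_i=-\rho^{-2}r_i\{e_i(r)-(r-r_i)e_i(\log\rho)\}$; - Laguerre tensor $\mathbb{L}=\sum_{ij}L_{ij}\omega_i\otimes\omega_j$, $L_{ij}=\rho^{-2}\{\mathrm{Hess}_{ij}(\log\rho)_{III}-r_ir_je_i(\log\rho)e_j(\log\rho)+\tfrac12(|\nabla_{III}\log\rho|^2-1)\delta_{ij}\}$,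 where Hessian (components in the $III$-orthonormal frame $r_ie_i$) and gradient are taken with respect to $III$. $x$ is L-isotropic if $\mathbb{C}=0$ and $L_{ij}=\lambda\delta_{ij}$ for a constant $\lambda\in\mathbb{R}$ (all eigenvalues of $\mathbb{L}$ equal to the same constant $\lambda$). $x$ is L-isoparametric if $\mathbb{C}=0$ and all Laguerre principal curvatures $b_i$ are constant. *)

theory Defs
  imports "HOL-Analysis.Analysis"
begin

section \<open>Smooth maps and smooth manifolds\<close>

abbreviation ddir :: "('a::real_normed_vector \<Rightarrow> 'b::real_normed_vector) \<Rightarrow> 'a \<Rightarrow> 'a \<Rightarrow> 'b" where
  "ddir f u v \<equiv> frechet_derivative f (at u) v"

text \<open>\<open>C^k\<close> and \<open>C^\<infinity>\<close> on an open subset \<open>U\<close> of a finite-dimensional space, where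
  continuity of the derivative is the same as continuity of all directional derivatives.\<close>

primrec Ck_on :: "nat \<Rightarrow> 'a::euclidean_space set \<Rightarrow> ('a \<Rightarrow> 'b::real_normed_vector) \<Rightarrow> bool" where
  "Ck_on 0 U f \<longleftrightarrow> continuous_on U f"
| "Ck_on (Suc k) U f \<longleftrightarrow> f differentiable_on U \<and> (\<forall>v. Ck_on k U (\<lambda>u. ddir f u v))"

definition smooth_on :: "'a::euclidean_space set \<Rightarrow> ('a \<Rightarrow> 'b::real_normed_vector) \<Rightarrow> bool" where
  "smooth_on U f \<longleftrightarrow> (\<forall>k. Ck_on k U f)"

text \<open>A local parametrization \<open>(U, \<phi>)\<close> is the inverse of a coordinate chart: \<open>\<phi>\<close> maps the open
  set \<open>U\<close> of coordinates homeomorphically onto an open subset of the manifold.\<close>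

type_synonym ('n, 'p) param = "(real ^ 'n) set \<times> (real ^ 'n \<Rightarrow> 'p)"

definition smooth_manifold :: "'p topology \<Rightarrow> ('n::finite, 'p) param set \<Rightarrow> bool" where
  "smooth_manifold M \<A> \<longleftrightarrow>
     Hausdorff_space M \<and> second_countable M \<and>
     (\<forall>(U, \<phi>) \<in> \<A>. open U \<and> openin M (\<phi> ` U) \<and>
        homeomorphic_map (top_of_set U) (subtopology M (\<phi> ` U)) \<phi>) \<and>
     (\<Union>(U, \<phi>) \<in> \<A>. \<phi> ` U) = topspace M \<and>
     (\<forall>(U, \<phi>) \<in> \<A>. \<forall>(V, \<psi>) \<in> \<A>.
        smooth_on {u \<in> U. \<phi> u \<in> \<psi> ` V} (\<lambda>u. inv_into V \<psi> (\<phi> u)))"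

section \<open>Oriented immersed hypersurfaces\<close>

text \<open>The orientation is given by the globally defined smooth unit normal \<open>\<xi>\<close>.\<close>

definition oriented_hypersurface ::
    "'p topology \<Rightarrow> ('n::finite, 'p) param set \<Rightarrow> ('p \<Rightarrow> real ^ 'm::finite) \<Rightarrow> ('p \<Rightarrow> real ^ 'm) \<Rightarrow> bool"
where
  "oriented_hypersurface M \<A> x \<xi> \<longleftrightarrow>
     smooth_manifold M \<A> \<and> CARD('m) = CARD('n) + 1 \<and>
     (\<forall>(U, \<phi>) \<in> \<A>.
        smooth_on U (x \<circ> \<phi>) \<and> smooth_on U (\<xi> \<circ> \<phi>) \<and>
        (\<forall>u \<in> U. inj (ddir (x \<circ> \<phi>) u) \<and> norm (\<xi> (\<phi> u)) = 1 \<and>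
           (\<forall>v. ddir (x \<circ> \<phi>) u v \<bullet> \<xi> (\<phi> u) = 0)))"

text \<open>In the following, \<open>X = x \<circ> \<phi>\<close> and \<open>N = \<xi> \<circ> \<phi>\<close> are the immersion and its unit normal in
  local coordinates, tangent vectors at the point with coordinates \<open>u\<close> are represented by their
  coordinate vectors, and \<open>k p i\<close> is the \<open>i\<close>-th principal curvature at \<open>p\<close>.
  The family \<open>e\<close> is a basis of unit principal vectors at a single point: all the Laguerre
  invariants involve only the values of the frame at the point, not its derivatives.\<close>

definition principal_frame ::
    "(real ^ 'n::finite \<Rightarrow> real ^ 'm::finite) \<Rightarrow> (real ^ 'n \<Rightarrow> real ^ 'm) \<Rightarrow> (real ^ 'n \<Rightarrow> 'n \<Rightarrow> real) \<Rightarrow>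
     real ^ 'n \<Rightarrow> ('n \<Rightarrow> real ^ 'n) \<Rightarrow> bool"
where
  "principal_frame X N k u e \<longleftrightarrow>
     (\<forall>i j. ddir X u (e i) \<bullet> ddir X u (e j) = (if i = j then 1 else 0)) \<and>
     (\<forall>i. ddir N u (e i) = - k u i *\<^sub>R ddir X u (e i))"

text \<open>\<open>k\<close> lists the principal curvatures, with multiplicity, at every point.\<close>

definition principal_curvatures ::
    "('n::finite, 'p) param set \<Rightarrow> ('p \<Rightarrow> real ^ 'm::finite) \<Rightarrow> ('p \<Rightarrow> real ^ 'm) \<Rightarrow> ('p \<Rightarrow> 'n \<Rightarrow> real) \<Rightarrow> bool"
where
  "principal_curvatures \<A> x \<xi> k \<longleftrightarrow>
     (\<forall>(U, \<phi>) \<in> \<A>. \<forall>u \<in> U. \<exists>e. principal_frame (x \<circ> \<phi>) (\<xi> \<circ> \<phi>) (k \<circ> \<phi>) u e)"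

definition umbilic :: "('p \<Rightarrow> 'n \<Rightarrow> real) \<Rightarrow> 'p \<Rightarrow> bool" where
  "umbilic k p \<longleftrightarrow> (\<forall>i j. k p i = k p j)"

definition radius :: "('p \<Rightarrow> 'n \<Rightarrow> real) \<Rightarrow> 'n \<Rightarrow> 'p \<Rightarrow> real" where
  "radius k i p = 1 / k p i"

definition mean_radius :: "('p \<Rightarrow> 'n::finite \<Rightarrow> real) \<Rightarrow> 'p \<Rightarrow> real" where
  "mean_radius k p = (\<Sum>i\<in>UNIV. radius k i p) / real CARD('n)"

definition rho :: "('p \<Rightarrow> 'n::finite \<Rightarrow> real) \<Rightarrow> 'p \<Rightarrow> real" where
  "rho k p = sqrt (\<Sum>i\<in>UNIV. (mean_radius k p - radius k i p)\<^sup>2)"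

section \<open>Third fundamental form\<close>

definition third_form :: "(real ^ 'n::finite \<Rightarrow> real ^ 'm::finite) \<Rightarrow> real ^ 'n \<Rightarrow> real ^ 'n \<Rightarrow> real ^ 'n \<Rightarrow> real" where
  "third_form N u v w = ddir N u v \<bullet> ddir N u w"

definition third_mat :: "(real ^ 'n::finite \<Rightarrow> real ^ 'm::finite) \<Rightarrow> real ^ 'n \<Rightarrow> real ^ 'n ^ 'n" where
  "third_mat N u = (\<chi> a b. third_form N u (axis a 1) (axis b 1))"

definition pd :: "'n::finite \<Rightarrow> (real ^ 'n \<Rightarrow> real) \<Rightarrow> real ^ 'n \<Rightarrow> real" where
  "pd a f u = ddir f u (axis a 1)"

text \<open>Christoffel symbols \<open>\<Gamma>^c_ab\<close> of the Levi-Civita connection of the third fundamental form,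
  and the corresponding covariant Hessian and gradient.\<close>

definition christoffel_III ::
    "(real ^ 'n::finite \<Rightarrow> real ^ 'm::finite) \<Rightarrow> real ^ 'n \<Rightarrow> 'n \<Rightarrow> 'n \<Rightarrow> 'n \<Rightarrow> real"
where
  "christoffel_III N u c a b =
     (\<Sum>d\<in>UNIV. matrix_inv (third_mat N u) $ c $ d *
        (pd a (\<lambda>w. third_mat N w $ b $ d) u + pd b (\<lambda>w. third_mat N w $ a $ d) u
         - pd d (\<lambda>w. third_mat N w $ a $ b) u)) / 2"

definition Hess_III ::
    "(real ^ 'n::finite \<Rightarrow> real ^ 'm::finite) \<Rightarrow> (real ^ 'n \<Rightarrow> real) \<Rightarrow> real ^ 'n \<Rightarrow> real ^ 'n \<Rightarrow> real ^ 'n \<Rightarrow> real"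
where
  "Hess_III N f u v w =
     (\<Sum>a\<in>UNIV. \<Sum>b\<in>UNIV. v $ a * w $ b *
        (pd a (pd b f) u - (\<Sum>c\<in>UNIV. christoffel_III N u c a b * pd c f u)))"

definition grad_III ::
    "(real ^ 'n::finite \<Rightarrow> real ^ 'm::finite) \<Rightarrow> (real ^ 'n \<Rightarrow> real) \<Rightarrow> real ^ 'n \<Rightarrow> real ^ 'n"
where
  "grad_III N f u = matrix_inv (third_mat N u) *v (\<chi> a. pd a f u)"

section \<open>Laguerre invariants\<close>

definition laguerre_metric ::
    "(real ^ 'n::finite \<Rightarrow> real ^ 'm::finite) \<Rightarrow> (real ^ 'n \<Rightarrow> 'n \<Rightarrow> real) \<Rightarrow>
     real ^ 'n \<Rightarrow> real ^ 'n \<Rightarrow> real ^ 'n \<Rightarrow> real"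
where
  "laguerre_metric N k u v w = (rho k u)\<^sup>2 * third_form N u v w"

definition laguerre_frame ::
    "(real ^ 'n::finite \<Rightarrow> 'n \<Rightarrow> real) \<Rightarrow> real ^ 'n \<Rightarrow> ('n \<Rightarrow> real ^ 'n) \<Rightarrow> 'n \<Rightarrow> real ^ 'n"
where
  "laguerre_frame k u e i = (radius k i u / rho k u) *\<^sub>R e i"

text \<open>The dual coframe \<open>\<omega>_i\<close>, as \<open>g(\<cdot>, E_i)\<close> for the \<open>g\<close>-orthonormal frame \<open>E_i\<close>.\<close>

definition laguerre_coframe ::
    "(real ^ 'n::finite \<Rightarrow> real ^ 'm::finite) \<Rightarrow> (real ^ 'n \<Rightarrow> 'n \<Rightarrow> real) \<Rightarrow>
     real ^ 'n \<Rightarrow> ('n \<Rightarrow> real ^ 'n) \<Rightarrow> 'n \<Rightarrow> real ^ 'n \<Rightarrow> real"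
where
  "laguerre_coframe N k u e i v = laguerre_metric N k u v (laguerre_frame k u e i)"

definition laguerre_curvature :: "('p \<Rightarrow> 'n::finite \<Rightarrow> real) \<Rightarrow> 'n \<Rightarrow> 'p \<Rightarrow> real" where
  "laguerre_curvature k i p = (mean_radius k p - radius k i p) / rho k p"

definition laguerre_C ::
    "(real ^ 'n::finite \<Rightarrow> 'n \<Rightarrow> real) \<Rightarrow> real ^ 'n \<Rightarrow> ('n \<Rightarrow> real ^ 'n) \<Rightarrow> 'n \<Rightarrow> real"
where
  "laguerre_C k u e i =
     - (radius k i u / (rho k u)\<^sup>2) *
       (ddir (mean_radius k) u (e i)
        - (mean_radius k u - radius k i u) * ddir (\<lambda>w. ln (rho k w)) u (e i))"

definition laguerre_form ::
    "(real ^ 'n::finite \<Rightarrow> real ^ 'm::finite) \<Rightarrow> (real ^ 'n \<Rightarrow> 'n \<Rightarrow> real) \<Rightarrow>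
     real ^ 'n \<Rightarrow> ('n \<Rightarrow> real ^ 'n) \<Rightarrow> real ^ 'n \<Rightarrow> real"
where
  "laguerre_form N k u e v = (\<Sum>i\<in>UNIV. laguerre_C k u e i * laguerre_coframe N k u e i v)"

definition laguerre_L ::
    "(real ^ 'n::finite \<Rightarrow> real ^ 'm::finite) \<Rightarrow> (real ^ 'n \<Rightarrow> 'n \<Rightarrow> real) \<Rightarrow>
     real ^ 'n \<Rightarrow> ('n \<Rightarrow> real ^ 'n) \<Rightarrow> real ^ 'n ^ 'n"
where
  "laguerre_L N k u e =
     (let f = (\<lambda>w. ln (rho k w)) in
      \<chi> i j. (Hess_III N f u (radius k i u *\<^sub>R e i) (radius k j u *\<^sub>R e j)
              - radius k i u * radius k j u * ddir f u (e i) * ddir f u (e j)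
              + (third_form N u (grad_III N f u) (grad_III N f u) - 1) / 2
                  * (if i = j then 1 else 0)) / (rho k u)\<^sup>2)"

definition laguerre_form_vanishes ::
    "('n::finite, 'p) param set \<Rightarrow> ('p \<Rightarrow> real ^ 'm::finite) \<Rightarrow> ('p \<Rightarrow> real ^ 'm) \<Rightarrow> ('p \<Rightarrow> 'n \<Rightarrow> real) \<Rightarrow> bool"
where
  "laguerre_form_vanishes \<A> x \<xi> k \<longleftrightarrow>
     (\<forall>(U, \<phi>) \<in> \<A>. \<forall>u \<in> U. \<forall>e. principal_frame (x \<circ> \<phi>) (\<xi> \<circ> \<phi>) (k \<circ> \<phi>) u e \<longrightarrow>
        (\<forall>v. laguerre_form (\<xi> \<circ> \<phi>) (k \<circ> \<phi>) u e v = 0))"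

text \<open>L-isotropic, with \<open>lam\<close> the common constant eigenvalue of the Laguerre tensor.\<close>

definition L_isotropic ::
    "('n::finite, 'p) param set \<Rightarrow> ('p \<Rightarrow> real ^ 'm::finite) \<Rightarrow> ('p \<Rightarrow> real ^ 'm) \<Rightarrow> ('p \<Rightarrow> 'n \<Rightarrow> real) \<Rightarrow>
     real \<Rightarrow> bool"
where
  "L_isotropic \<A> x \<xi> k lam \<longleftrightarrow>
     laguerre_form_vanishes \<A> x \<xi> k \<and>
     (\<forall>(U, \<phi>) \<in> \<A>. \<forall>u \<in> U. \<forall>e. principal_frame (x \<circ> \<phi>) (\<xi> \<circ> \<phi>) (k \<circ> \<phi>) u e \<longrightarrow>
        (\<forall>i j. laguerre_L (\<xi> \<circ> \<phi>) (k \<circ> \<phi>) u e $ i $ j = lam * (if i = j then 1 else 0)))"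

definition L_isoparametric ::
    "'p topology \<Rightarrow> ('n::finite, 'p) param set \<Rightarrow> ('p \<Rightarrow> real ^ 'm::finite) \<Rightarrow> ('p \<Rightarrow> real ^ 'm) \<Rightarrow>
     ('p \<Rightarrow> 'n \<Rightarrow> real) \<Rightarrow> bool"
where
  "L_isoparametric M \<A> x \<xi> k \<longleftrightarrow>
     laguerre_form_vanishes \<A> x \<xi> k \<and>
     (\<forall>i. \<exists>c. \<forall>p \<in> topspace M. laguerre_curvature k i p = c)"

text \<open>\<open>\<mu>\<close> is an eigenvalue of the Laguerre tensor at \<open>p\<close>, with respect to the Laguerre metric; its
  component matrix in a principal frame refers to the \<open>g\<close>-orthonormal frame \<open>E_i\<close>.\<close>

definition laguerre_eigenvalue ::
    "('n::finite, 'p) param set \<Rightarrow> ('p \<Rightarrow> real ^ 'm::finite) \<Rightarrow> ('p \<Rightarrow> real ^ 'm) \<Rightarrow> ('p \<Rightarrow> 'n \<Rightarrow> real) \<Rightarrow>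
     'p \<Rightarrow> real \<Rightarrow> bool"
where
  "laguerre_eigenvalue \<A> x \<xi> k p \<mu> \<longleftrightarrow>
     (\<exists>(U, \<phi>) \<in> \<A>. \<exists>u \<in> U. \<exists>e w. \<phi> u = p \<and>
        principal_frame (x \<circ> \<phi>) (\<xi> \<circ> \<phi>) (k \<circ> \<phi>) u e \<and>
        w \<noteq> 0 \<and> laguerre_L (\<xi> \<circ> \<phi>) (k \<circ> \<phi>) u e *v w = \<mu> *\<^sub>R w)"

end

theory Submission
  imports Defs
begin

text \<open>
  Let \<open>r\<close> be the mean radius of curvature and \<open>N\<close> the unit normal, and consider the null vector field
  \<open>Y = \<rho> (N, 1)\<close> and \<open>\<eta> = (x + r N, r)\<close> with values in Lorentz space. The Laguerre metric is the metric
  induced by \<open>Y\<close>, and \<open>\<real> Y\<close> together with a second null direction \<open>Z\<close> is its normal bundle. The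
  vanishing of the Laguerre form says exactly that \<open>d\<eta>(E_i) = b_i dY(E_i)\<close>, and the Laguerre tensor is
  the \<open>Z\<close>-component of the second derivative of \<open>Y\<close>; so L-isotropy means that the Laguerre
  metric has constant curvature \<open>-2 \<lambda>\<close>, and the second fundamental form is a Codazzi tensor for it
  with constant, distinct eigenvalues \<open>b_i\<close>. As for isoparametric hypersurfaces, with \<open>B_ijm\<close>
  the components of its covariant derivative the Gauss equation becomes
  \<open>-\<lambda> = \<Sum>_m B_ijm^2 / ((b_i - b_m) (b_j - b_m))\<close> for \<open>i \<noteq> j\<close>, where \<open>m\<close> runs over the indices other
  than \<open>i, j\<close>. If \<open>b_i\<close> is the largest eigenvalue, the right-hand side is nonpositive for \<open>b_j\<close> the
  smallest one and nonnegative for \<open>b_j\<close> the second largest one, hence \<open>\<lambda> = 0\<close>.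
\<close>

section \<open>Calculus of C^k and smooth maps on open sets\<close>

section \<open>Smooth functions\<close>

lemma ddir_eqI: "(f has_derivative f') (at u) \<Longrightarrow> ddir f u v = f' v"
  using frechet_derivative_at by metis

text \<open>On an open set, equal functions have equal derivatives, so the agreement passes to every
  order. \<open>ddir\<close> is a total function with no control outside \<open>U\<close>; this
  lemma lets derivatives be replaced by formulas valid on \<open>U\<close> only.\<close>

lemma Ck_on_cong:
  assumes "open U" "\<And>u. u \<in> U \<Longrightarrow> f u = g u"
  shows "Ck_on k U f \<longleftrightarrow> Ck_on k U g"
  using assms(2)
proof (induction k arbitrary: f g)
  case 0
  then show ?case by (simp cong: continuous_on_cong)
next
  case (Suc k)
  have hd: "(g has_derivative ddir f u) (at u)"
    if "\<And>u. u \<in> U \<Longrightarrow> f u = g u" "f differentiable_on U" "u \<in> U" for f g :: "'a \<Rightarrow> 'b" and u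
  proof -
    have "(f has_derivative ddir f u) (at u)"
      using that assms(1) by (simp add: differentiable_on_eq_differentiable_at frechet_derivative_works)
    then show ?thesis
      using assms(1) that(3,1) by (rule has_derivative_transform_within_open)
  qed
  have *: "g differentiable_on U"
    if "\<And>u. u \<in> U \<Longrightarrow> f u = g u" "f differentiable_on U" for f g :: "'a \<Rightarrow> 'b"
    using hd[OF that] assms(1) unfolding differentiable_on_eq_differentiable_at[OF assms(1)] differentiable_def
    by blast
  have d: "f differentiable_on U \<longleftrightarrow> g differentiable_on U"
    using *[of f g] *[of g f] Suc.prems by auto
  have "Ck_on k U (\<lambda>u. ddir f u v) \<longleftrightarrow> Ck_on k U (\<lambda>u. ddir g u v)" if "f differentiable_on U" for v
    by (rule Suc.IH, rule ddir_eqI[symmetric], rule hd) (use that Suc.prems in auto)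
  then show ?case using d by auto
qed

lemma Ck_on_subset: "open V \<Longrightarrow> V \<subseteq> U \<Longrightarrow> Ck_on k U f \<Longrightarrow> Ck_on k V f"
  by (induction k arbitrary: f) (auto intro: continuous_on_subset differentiable_on_subset)

lemma Ck_on_Suc: "Ck_on (Suc k) U f \<Longrightarrow> Ck_on k U f"
  by (induction k arbitrary: f) (auto intro: differentiable_imp_continuous_on)

lemma Ck_on_Suc_has_derivative:
  assumes "open U" "Ck_on (Suc k) U f" "u \<in> U"
  shows "(f has_derivative ddir f u) (at u)"
  using assms by (simp add: differentiable_on_eq_differentiable_at frechet_derivative_works)

text \<open>Lets an explicit derivative \<open>D\<close> stand in for the chosen
  \<open>frechet_derivative\<close>; each closure property below is an induction on \<open>k\<close>
  through this rule.\<close>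

lemma Ck_on_SucI:
  assumes "open U" "\<And>u. u \<in> U \<Longrightarrow> (f has_derivative D u) (at u)"
    "\<And>v. Ck_on k U (\<lambda>u. D u v)"
  shows "Ck_on (Suc k) U f"
proof -
  have "Ck_on k U (\<lambda>u. ddir f u v)" for v
    using assms(3)[of v] Ck_on_cong[OF assms(1), of "\<lambda>u. ddir f u v" "\<lambda>u. D u v"]
    by (simp add: ddir_eqI[OF assms(2)])
  moreover have "f differentiable_on U"
    using assms(1,2) by (auto simp: differentiable_on_eq_differentiable_at differentiable_def)
  ultimately show ?thesis by simp
qed

lemma Ck_on_const: "Ck_on k U (\<lambda>u. c)"
  by (induction k arbitrary: c) (auto simp: differentiable_on_def)

lemma Ck_on_add: "open U \<Longrightarrow> Ck_on k U f \<Longrightarrow> Ck_on k U g \<Longrightarrow> Ck_on k U (\<lambda>u. f u + g u)"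
proof (induction k arbitrary: f g)
  case 0
  then show ?case by (simp add: continuous_on_add)
next
  case (Suc k)
  show ?case
    by (rule Ck_on_SucI[OF Suc.prems(1), where D = "\<lambda>u v. ddir f u v + ddir g u v"])
      (use Suc in \<open>auto intro!: has_derivative_add Ck_on_Suc_has_derivative simp del: Ck_on.simps\<close>,
       use Suc in auto)
qed

lemma (in bounded_linear) Ck_on: "open U \<Longrightarrow> Ck_on k U g \<Longrightarrow> Ck_on k U (\<lambda>u. f (g u))"
proof (induction k arbitrary: g)
  case 0
  then show ?case by (simp add: continuous_on)
next
  case (Suc k)
  show ?case
    by (rule Ck_on_SucI[OF Suc.prems(1), where D = "\<lambda>u v. f (ddir g u v)"])
      (use Suc in \<open>auto intro!: has_derivative Ck_on_Suc_has_derivative simp del: Ck_on.simps\<close>,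
       use Suc in auto)
qed

lemma (in bounded_bilinear) Ck_on:
  "open U \<Longrightarrow> Ck_on k U f \<Longrightarrow> Ck_on k U g \<Longrightarrow> Ck_on k U (\<lambda>u. prod (f u) (g u))"
proof (induction k arbitrary: f g)
  case 0
  then show ?case by (simp add: continuous_on)
next
  case (Suc k)
  have "Ck_on k U f" "Ck_on k U g" using Suc.prems Ck_on_Suc by blast+
  then have "Ck_on k U (\<lambda>u. prod (f u) (ddir g u v) + prod (ddir f u v) (g u))" for v
    using Suc by (intro Ck_on_add Suc.IH) auto
  moreover have "((\<lambda>u. prod (f u) (g u)) has_derivative
      (\<lambda>v. prod (f u) (ddir g u v) + prod (ddir f u v) (g u))) (at u)" if "u \<in> U" for u
    using Suc.prems that by (intro FDERIV Ck_on_Suc_has_derivative)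
  ultimately show ?case by (intro Ck_on_SucI[OF Suc.prems(1)])
qed

text \<open>The derivative of \<open>1/f\<close> is built from \<open>ddir f\<close> and
  \<open>1/f\<close> itself, and the latter is C^k by the induction hypothesis; so the induction
  keeps \<open>f\<close> fixed.\<close>

lemma Ck_on_inverse:
  fixes f :: "'a::euclidean_space \<Rightarrow> real"
  assumes "open U" and nz: "\<And>u. u \<in> U \<Longrightarrow> f u \<noteq> 0"
  shows "Ck_on k U f \<Longrightarrow> Ck_on k U (\<lambda>u. inverse (f u))"
proof (induction k)
  case 0
  then show ?case using nz by (auto intro!: continuous_on_inverse)
next
  case (Suc k)
  have "Ck_on k U (\<lambda>u. inverse (f u))" using Suc Ck_on_Suc by blast
  then have "Ck_on k U (\<lambda>u. - (inverse (f u) * ddir f u v * inverse (f u)))" for v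
    using Suc.prems assms(1)
    by (intro bounded_linear.Ck_on[OF bounded_linear_minus[OF bounded_linear_ident]]
        bounded_bilinear.Ck_on[OF bounded_bilinear_mult]) auto
  moreover have "((\<lambda>u. inverse (f u)) has_derivative
      (\<lambda>v. - (inverse (f u) * ddir f u v * inverse (f u)))) (at u)" if "u \<in> U" for u
    using Suc.prems assms(1) that nz by (intro Deriv.has_derivative_inverse Ck_on_Suc_has_derivative) auto
  ultimately show ?case by (intro Ck_on_SucI[OF assms(1)])
qed

lemma Ck_on_sqrt:
  fixes f :: "'a::euclidean_space \<Rightarrow> real"
  assumes "open U" and pos: "\<And>u. u \<in> U \<Longrightarrow> f u > 0"
  shows "Ck_on k U f \<Longrightarrow> Ck_on k U (\<lambda>u. sqrt (f u))"
proof (induction k)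
  case 0
  then show ?case by (auto intro!: continuous_on_real_sqrt)
next
  case (Suc k)
  have "Ck_on k U (\<lambda>u. sqrt (f u))" using Suc Ck_on_Suc by blast
  then have "Ck_on k U (\<lambda>u. ddir f u v * inverse (2 * sqrt (f u)))" for v
    using Suc.prems assms
    by (intro bounded_bilinear.Ck_on[OF bounded_bilinear_mult] Ck_on_inverse Ck_on_const)
      (auto simp: less_imp_neq[THEN not_sym])
  moreover have "((\<lambda>u. sqrt (f u)) has_derivative
      (\<lambda>v. ddir f u v * inverse (2 * sqrt (f u)))) (at u)" if "u \<in> U" for u
  proof -
    have "((\<lambda>u. sqrt (f u)) has_derivative (\<lambda>v. ddir f u v * (inverse (sqrt (f u)) / 2))) (at u)"
      using Suc.prems assms that
      by (intro DERIV_compose_FDERIV[of sqrt] DERIV_real_sqrt Ck_on_Suc_has_derivative) auto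
    then show ?thesis by (simp add: field_simps)
  qed
  ultimately show ?case by (intro Ck_on_SucI[OF assms(1)])
qed

lemma Ck_on_ln:
  fixes f :: "'a::euclidean_space \<Rightarrow> real"
  assumes "open U" and pos: "\<And>u. u \<in> U \<Longrightarrow> f u > 0"
  shows "Ck_on k U f \<Longrightarrow> Ck_on k U (\<lambda>u. ln (f u))"
proof (induction k)
  case 0
  then show ?case using pos by (auto intro!: continuous_on_ln simp: less_imp_neq[THEN not_sym])
next
  case (Suc k)
  have "Ck_on k U (\<lambda>u. ddir f u v * inverse (f u))" for v
    using Suc.prems assms Ck_on_Suc[OF Suc.prems]
    by (intro bounded_bilinear.Ck_on[OF bounded_bilinear_mult] Ck_on_inverse)
      (auto simp: less_imp_neq[THEN not_sym])
  moreover have "((\<lambda>u. ln (f u)) has_derivative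
      (\<lambda>v. ddir f u v * inverse (f u))) (at u)" if "u \<in> U" for u
    using Suc.prems assms that
    by (intro DERIV_compose_FDERIV[of ln] DERIV_ln Ck_on_Suc_has_derivative) auto
  ultimately show ?case by (intro Ck_on_SucI[OF assms(1)])
qed

lemma smooth_on_has_derivative:
  "open U \<Longrightarrow> smooth_on U f \<Longrightarrow> u \<in> U \<Longrightarrow> (f has_derivative ddir f u) (at u)"
  unfolding smooth_on_def by (blast intro: Ck_on_Suc_has_derivative)

lemma smooth_on_linear: "open U \<Longrightarrow> smooth_on U f \<Longrightarrow> u \<in> U \<Longrightarrow> linear (ddir f u)"
  by (rule has_derivative_linear[OF smooth_on_has_derivative])

lemma smooth_on_cong:
  "open U \<Longrightarrow> (\<And>u. u \<in> U \<Longrightarrow> f u = g u) \<Longrightarrow> smooth_on U f \<longleftrightarrow> smooth_on U g"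
  unfolding smooth_on_def by (intro all_cong1 Ck_on_cong)

lemma ddir_cong:
  assumes "open U" "smooth_on U f" "u \<in> U" "\<And>u. u \<in> U \<Longrightarrow> f u = g u"
  shows "ddir f u v = ddir g u v"
proof -
  have "(g has_derivative ddir f u) (at u)"
    using smooth_on_has_derivative[OF assms(1-3)] assms(1,3,4)
    by (rule has_derivative_transform_within_open)
  then show ?thesis by (simp add: ddir_eqI)
qed

lemma smooth_on_subset: "open V \<Longrightarrow> V \<subseteq> U \<Longrightarrow> smooth_on U f \<Longrightarrow> smooth_on V f"
  unfolding smooth_on_def by (blast intro: Ck_on_subset)

lemma smooth_on_continuous: "smooth_on U f \<Longrightarrow> continuous_on U f"
  unfolding smooth_on_def by (metis Ck_on.simps(1))

lemma smooth_on_const: "smooth_on U (\<lambda>u. c)"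
  by (simp add: smooth_on_def Ck_on_const)

lemma smooth_on_add: "open U \<Longrightarrow> smooth_on U f \<Longrightarrow> smooth_on U g \<Longrightarrow> smooth_on U (\<lambda>u. f u + g u)"
  by (simp add: smooth_on_def Ck_on_add)

lemma (in bounded_linear) smooth_on: "open U \<Longrightarrow> smooth_on U g \<Longrightarrow> smooth_on U (\<lambda>u. f (g u))"
  by (simp add: smooth_on_def Ck_on)

lemma (in bounded_bilinear) smooth_on:
  "open U \<Longrightarrow> smooth_on U f \<Longrightarrow> smooth_on U g \<Longrightarrow> smooth_on U (\<lambda>u. prod (f u) (g u))"
  by (simp add: smooth_on_def Ck_on)

lemmas smooth_on_mult = bounded_bilinear.smooth_on[OF bounded_bilinear_mult]
lemmas smooth_on_scaleR = bounded_bilinear.smooth_on[OF bounded_bilinear_scaleR]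
lemmas smooth_on_inner = bounded_bilinear.smooth_on[OF bounded_bilinear_inner]
lemmas smooth_on_minus = bounded_linear.smooth_on[OF bounded_linear_minus[OF bounded_linear_ident]]
lemmas smooth_on_vec_nth = bounded_linear.smooth_on[OF bounded_linear_vec_nth]

lemma smooth_on_diff:
  "open U \<Longrightarrow> smooth_on U f \<Longrightarrow> smooth_on U g \<Longrightarrow> smooth_on U (\<lambda>u. f u - g u)"
  using smooth_on_add[of U f "\<lambda>u. - g u"] smooth_on_minus[of U g] by simp

lemma smooth_on_sum:
  "open U \<Longrightarrow> (\<And>i. i \<in> I \<Longrightarrow> smooth_on U (f i)) \<Longrightarrow> smooth_on U (\<lambda>u. \<Sum>i\<in>I. f i u)"
  by (induction I rule: infinite_finite_induct) (auto intro: smooth_on_const smooth_on_add)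

lemma smooth_on_prod:
  fixes f :: "'i \<Rightarrow> 'a::euclidean_space \<Rightarrow> real"
  shows "open U \<Longrightarrow> (\<And>i. i \<in> I \<Longrightarrow> smooth_on U (f i)) \<Longrightarrow> smooth_on U (\<lambda>u. \<Prod>i\<in>I. f i u)"
  by (induction I rule: infinite_finite_induct) (auto intro: smooth_on_const smooth_on_mult)

lemma smooth_on_inverse:
  fixes f :: "'a::euclidean_space \<Rightarrow> real"
  shows "open U \<Longrightarrow> smooth_on U f \<Longrightarrow> (\<And>u. u \<in> U \<Longrightarrow> f u \<noteq> 0) \<Longrightarrow> smooth_on U (\<lambda>u. inverse (f u))"
  by (simp add: smooth_on_def Ck_on_inverse)

lemma smooth_on_divide:
  fixes f :: "'a::euclidean_space \<Rightarrow> real"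
  shows "open U \<Longrightarrow> smooth_on U f \<Longrightarrow> smooth_on U g \<Longrightarrow> (\<And>u. u \<in> U \<Longrightarrow> g u \<noteq> 0) \<Longrightarrow>
    smooth_on U (\<lambda>u. f u / g u)"
  by (simp add: divide_inverse smooth_on_mult smooth_on_inverse)

lemma smooth_on_sqrt:
  fixes f :: "'a::euclidean_space \<Rightarrow> real"
  shows "open U \<Longrightarrow> smooth_on U f \<Longrightarrow> (\<And>u. u \<in> U \<Longrightarrow> f u > 0) \<Longrightarrow> smooth_on U (\<lambda>u. sqrt (f u))"
  by (simp add: smooth_on_def Ck_on_sqrt)

lemma smooth_on_ln:
  fixes f :: "'a::euclidean_space \<Rightarrow> real"
  shows "open U \<Longrightarrow> smooth_on U f \<Longrightarrow> (\<And>u. u \<in> U \<Longrightarrow> f u > 0) \<Longrightarrow> smooth_on U (\<lambda>u. ln (f u))"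
  by (simp add: smooth_on_def Ck_on_ln)

lemma smooth_on_Pair:
  fixes f :: "'a::euclidean_space \<Rightarrow> 'b::real_normed_vector" and g :: "'a \<Rightarrow> 'c::real_normed_vector"
  assumes "open U" "smooth_on U f" "smooth_on U g"
  shows "smooth_on U (\<lambda>u. (f u, g u))"
proof -
  have "bounded_linear (\<lambda>x::'b. (x, 0::'c))" "bounded_linear (\<lambda>x::'c. (0::'b, x))"
    by (intro bounded_linear_Pair bounded_linear_ident bounded_linear_zero)+
  then have "smooth_on U (\<lambda>u. (f u, 0) + (0, g u))"
    using bounded_linear.smooth_on[of "\<lambda>x. (x, 0::'c)" U f] bounded_linear.smooth_on[of "\<lambda>x. (0::'b, x)" U g]
      assms by (intro smooth_on_add) auto
  then show ?thesis by simp
qed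

lemma smooth_on_vec_lambda:
  fixes f :: "'i::finite \<Rightarrow> 'a::euclidean_space \<Rightarrow> real"
  assumes "open U" "\<And>i. smooth_on U (f i)"
  shows "smooth_on U (\<lambda>u. \<chi> i. f i u)"
proof -
  have "(\<lambda>u. \<chi> i. f i u) = (\<lambda>u. \<Sum>i\<in>UNIV. f i u *\<^sub>R axis i 1)"
    by (auto simp: vec_eq_iff axis_def if_distrib cong: if_cong)
  then show ?thesis
    by (simp only:) (intro smooth_on_sum smooth_on_scaleR smooth_on_const assms)
qed

section \<open>Derivatives along vector fields\<close>

lemma smooth_on_ddir_const: "smooth_on U f \<Longrightarrow> smooth_on U (\<lambda>u. ddir f u v)"
  unfolding smooth_on_def by (metis Ck_on.simps(2))

lemma linear_expand_axis: "linear L \<Longrightarrow> L v = (\<Sum>a\<in>UNIV. v $ a *\<^sub>R L (axis a 1))"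
  for v :: "real ^ 'n::finite"
proof -
  assume "linear L"
  have "v = (\<Sum>a\<in>UNIV. v $ a *\<^sub>R axis a 1)"
    by (auto simp: vec_eq_iff axis_def if_distrib cong: if_cong)
  then have "L v = L (\<Sum>a\<in>UNIV. v $ a *\<^sub>R axis a 1)" by simp
  then show ?thesis using \<open>linear L\<close> by (simp add: linear_sum linear_cmul)
qed

lemma ddir_expand:
  fixes f :: "real ^ 'n::finite \<Rightarrow> 'b::real_normed_vector"
  assumes "open U" "smooth_on U f" "u \<in> U"
  shows "ddir f u v = (\<Sum>a\<in>UNIV. v $ a *\<^sub>R ddir f u (axis a 1))"
  by (rule linear_expand_axis[OF smooth_on_linear[OF assms]])

text \<open>Expanding the moving direction \<open>G u\<close> in the standard basis leaves only
  derivatives in constant directions.\<close>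

lemma smooth_on_ddir:
  fixes f :: "real ^ 'n::finite \<Rightarrow> 'b::real_normed_vector"
  assumes "open U" "smooth_on U f" "smooth_on U G"
  shows "smooth_on U (\<lambda>u. ddir f u (G u))"
proof -
  have "smooth_on U (\<lambda>u. \<Sum>a\<in>UNIV. G u $ a *\<^sub>R ddir f u (axis a 1))"
    using assms by (intro smooth_on_sum smooth_on_scaleR smooth_on_vec_nth smooth_on_ddir_const)
  then show ?thesis
    by (rule smooth_on_cong[OF assms(1), THEN iffD2, rotated]) (rule ddir_expand[OF assms(1,2)])
qed

lemma ddir_add:
  "open U \<Longrightarrow> smooth_on U f \<Longrightarrow> smooth_on U g \<Longrightarrow> u \<in> U \<Longrightarrow>
    ddir (\<lambda>u. f u + g u) u v = ddir f u v + ddir g u v"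
  by (rule ddir_eqI) (intro has_derivative_add smooth_on_has_derivative)

lemma ddir_Pair:
  assumes "open U" "smooth_on U f" "smooth_on U g" "u \<in> U"
  shows "ddir (\<lambda>u. (f u, g u)) u v = (ddir f u v, ddir g u v)"
  by (rule ddir_eqI) (intro has_derivative_Pair smooth_on_has_derivative[OF assms(1)] assms)

lemma (in bounded_bilinear) ddir:
  "open U \<Longrightarrow> smooth_on U f \<Longrightarrow> smooth_on U g \<Longrightarrow> u \<in> U \<Longrightarrow>
    ddir (\<lambda>u. prod (f u) (g u)) u v = prod (f u) (ddir g u v) + prod (ddir f u v) (g u)"
  by (rule ddir_eqI) (intro FDERIV smooth_on_has_derivative)

lemma (in bounded_linear) ddir:
  "open U \<Longrightarrow> smooth_on U g \<Longrightarrow> u \<in> U \<Longrightarrow> ddir (\<lambda>u. f (g u)) u v = f (ddir g u v)"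
  by (rule ddir_eqI) (intro has_derivative smooth_on_has_derivative)

text \<open>Product rule for \<open>dF(G)\<close>. In the first summand the direction is frozen at
  \<open>G u\<close>, so that this term is the bare second derivative of \<open>F\<close>; the
  second summand collects the variation of \<open>G\<close>.\<close>

lemma ddir_ddir_field:
  fixes F :: "real ^ 'n::finite \<Rightarrow> 'b::real_normed_vector"
  assumes U: "open U" "smooth_on U F" "smooth_on U G" "u \<in> U"
  shows "ddir (\<lambda>u. ddir F u (G u)) u v = ddir (\<lambda>w. ddir F w (G u)) u v + ddir F u (ddir G u v)"
proof -
  let ?H = "\<lambda>w. \<Sum>a\<in>UNIV. G w $ a *\<^sub>R ddir F w (axis a 1)"
  have 1: "((\<lambda>w. G w $ a *\<^sub>R ddir F w (axis a 1)) has_derivative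
      (\<lambda>v. G u $ a *\<^sub>R ddir (\<lambda>w. ddir F w (axis a 1)) u v + (ddir G u v $ a) *\<^sub>R ddir F u (axis a 1))) (at u)" for a
    using U by (intro has_derivative_scaleR bounded_linear.has_derivative[OF bounded_linear_vec_nth]
        smooth_on_has_derivative[where U = U] smooth_on_ddir_const)
  have "smooth_on U (\<lambda>u. ddir F u (G u))" using U by (intro smooth_on_ddir)
  then have "ddir (\<lambda>u. ddir F u (G u)) u v = ddir ?H u v"
    by (rule ddir_cong[OF U(1) _ U(4) ddir_expand[OF U(1,2)]])
  also have "\<dots> = (\<Sum>a\<in>UNIV. G u $ a *\<^sub>R ddir (\<lambda>w. ddir F w (axis a 1)) u v + (ddir G u v $ a) *\<^sub>R ddir F u (axis a 1))"
    using 1 by (intro ddir_eqI has_derivative_sum)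
  also have "\<dots> = (\<Sum>a\<in>UNIV. G u $ a *\<^sub>R ddir (\<lambda>w. ddir F w (axis a 1)) u v) + ddir F u (ddir G u v)"
    by (simp add: sum.distrib ddir_expand[OF U(1,2,4), of "ddir G u v"])
  also have "(\<Sum>a\<in>UNIV. G u $ a *\<^sub>R ddir (\<lambda>w. ddir F w (axis a 1)) u v) = ddir (\<lambda>w. \<Sum>a\<in>UNIV. G u $ a *\<^sub>R ddir F w (axis a 1)) u v"
    using U by (intro ddir_eqI[symmetric] has_derivative_sum has_derivative_scaleR_right
        smooth_on_has_derivative[where U = U] smooth_on_ddir_const)
  also have "\<dots> = ddir (\<lambda>w. ddir F w (G u)) u v"
    by (rule ddir_cong[OF U(1) smooth_on_ddir_const[OF U(2)] U(4) ddir_expand[OF U(1,2)], symmetric])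
  finally show ?thesis .
qed

section \<open>Symmetry of second derivatives and the Lie bracket\<close>

lemma second_difference_mvt:
  fixes f :: "'a::euclidean_space \<Rightarrow> real"
  assumes "open U" "smooth_on U f" "h > 0"
    and sub: "\<And>s t. 0 \<le> s \<Longrightarrow> s \<le> h \<Longrightarrow> 0 \<le> t \<Longrightarrow> t \<le> h \<Longrightarrow> u + s *\<^sub>R v + t *\<^sub>R w \<in> U"
  obtains s t where "0 \<le> s" "s \<le> h" "0 \<le> t" "t \<le> h"
    "f (u + h *\<^sub>R v + h *\<^sub>R w) - f (u + h *\<^sub>R v) - f (u + h *\<^sub>R w) + f u
       = h * h * ddir (\<lambda>p. ddir f p v) (u + s *\<^sub>R v + t *\<^sub>R w) w"
proof -
  have hd: "(g has_real_derivative D) (at s)" if "(g has_derivative L) (at s)" "\<And>x. L x = x * D" for g :: "real \<Rightarrow> real" and L D s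
  proof -
    have "L = (*) D" using that(2) by (simp add: fun_eq_iff mult.commute)
    then show ?thesis using that(1) by (simp add: has_field_derivative_def)
  qed
  have sm: "smooth_on U (\<lambda>p. ddir f p v)" using assms(2) by (rule smooth_on_ddir_const)
  \<comment> \<open>The increment of \<open>f\<close> in direction \<open>w\<close>, as a function
    of the displacement along \<open>v\<close>. One mean value theorem for \<open>g\<close> produces
    a derivative along \<open>v\<close>; a second one, in \<open>t\<close>, produces the derivative
    along \<open>w\<close>.\<close>
  define g where "g s = f (u + s *\<^sub>R v + h *\<^sub>R w) - f (u + s *\<^sub>R v)" for s
  have d1: "((\<lambda>s. f (u + s *\<^sub>R v + t *\<^sub>R w)) has_real_derivative ddir f (u + s *\<^sub>R v + t *\<^sub>R w) v) (at s)"
    if "0 \<le> s" "s \<le> h" "0 \<le> t" "t \<le> h" for s t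
  proof (rule hd)
    show "((\<lambda>s. f (u + s *\<^sub>R v + t *\<^sub>R w)) has_derivative
        (\<lambda>x. ddir f (u + s *\<^sub>R v + t *\<^sub>R w) (x *\<^sub>R v))) (at s)"
      by (rule has_derivative_compose[of "\<lambda>s. u + s *\<^sub>R v + t *\<^sub>R w" "\<lambda>x. x *\<^sub>R v" s UNIV f])
       (use assms sub that in \<open>auto intro!: derivative_eq_intros smooth_on_has_derivative\<close>)
    show "ddir f (u + s *\<^sub>R v + t *\<^sub>R w) (x *\<^sub>R v) = x * ddir f (u + s *\<^sub>R v + t *\<^sub>R w) v" for x
      using smooth_on_linear[OF assms(1,2) sub[OF that]] by (simp add: linear_cmul)
  qed
  have "\<exists>s>0. s < h \<and> g h - g 0 = (h - 0) * (ddir f (u + s *\<^sub>R v + h *\<^sub>R w) v - ddir f (u + s *\<^sub>R v) v)"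
    using assms(3) d1[of _ h] d1[of _ 0] unfolding g_def by (intro MVT2) (auto intro!: DERIV_diff)
  then obtain s where s: "0 < s" "s < h"
    "g h - g 0 = h * (ddir f (u + s *\<^sub>R v + h *\<^sub>R w) v - ddir f (u + s *\<^sub>R v) v)" by auto
  have d2: "((\<lambda>t. ddir f (u + s *\<^sub>R v + t *\<^sub>R w) v) has_real_derivative
      ddir (\<lambda>p. ddir f p v) (u + s *\<^sub>R v + t *\<^sub>R w) w) (at t)"
    if "0 \<le> t" "t \<le> h" for t
  proof (rule hd)
    have i: "u + s *\<^sub>R v + t *\<^sub>R w \<in> U" using sub that s by auto
    show "((\<lambda>t. ddir f (u + s *\<^sub>R v + t *\<^sub>R w) v) has_derivative
        (\<lambda>x. ddir (\<lambda>p. ddir f p v) (u + s *\<^sub>R v + t *\<^sub>R w) (x *\<^sub>R w))) (at t)"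
      by (rule has_derivative_compose[of "\<lambda>t. u + s *\<^sub>R v + t *\<^sub>R w" "\<lambda>x. x *\<^sub>R w" t UNIV "\<lambda>p. ddir f p v"])
       (use assms(1) i sm in \<open>auto intro!: derivative_eq_intros smooth_on_has_derivative\<close>)
    show "ddir (\<lambda>p. ddir f p v) (u + s *\<^sub>R v + t *\<^sub>R w) (x *\<^sub>R w)
        = x * ddir (\<lambda>p. ddir f p v) (u + s *\<^sub>R v + t *\<^sub>R w) w" for x
      using smooth_on_linear[OF assms(1) sm i] by (simp add: linear_cmul)
  qed
  have "\<exists>t>0. t < h \<and> ddir f (u + s *\<^sub>R v + h *\<^sub>R w) v - ddir f (u + s *\<^sub>R v + 0 *\<^sub>R w) v
      = (h - 0) * ddir (\<lambda>p. ddir f p v) (u + s *\<^sub>R v + t *\<^sub>R w) w"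
    using assms(3) d2 by (intro MVT2) auto
  then obtain t where "0 < t" "t < h" "ddir f (u + s *\<^sub>R v + h *\<^sub>R w) v - ddir f (u + s *\<^sub>R v) v
      = h * ddir (\<lambda>p. ddir f p v) (u + s *\<^sub>R v + t *\<^sub>R w) w" by auto
  with s show ?thesis unfolding g_def by (intro that[of s t]) auto
qed

text \<open>The second difference over a parallelogram is symmetric in \<open>v\<close> and
  \<open>w\<close>, and equals \<open>h * h\<close> times either mixed derivative at some point of
  the parallelogram. Continuity of both mixed derivatives then makes them agree at
  \<open>u\<close>.\<close>

lemma ddir_ddir_sym_real:
  fixes f :: "'a::euclidean_space \<Rightarrow> real"
  assumes "open U" "smooth_on U f" "u \<in> U"
  shows "ddir (\<lambda>p. ddir f p v) u w = ddir (\<lambda>p. ddir f p w) u v"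
proof (rule ccontr)
  let ?A = "\<lambda>p. ddir (\<lambda>p. ddir f p v) p w" and ?B = "\<lambda>p. ddir (\<lambda>p. ddir f p w) p v"
  assume "?A u \<noteq> ?B u"
  define e where "e = dist (?A u) (?B u) / 2"
  have e: "e > 0" using \<open>?A u \<noteq> ?B u\<close> by (simp add: e_def)
  have "continuous_on U ?A" "continuous_on U ?B"
    by (intro smooth_on_continuous smooth_on_ddir_const assms(2))+
  then have c: "isCont ?A u" "isCont ?B u"
    using assms(1,3) continuous_on_eq_continuous_at[OF assms(1)] by blast+
  obtain d1 where d1: "d1 > 0" "\<And>p. dist p u < d1 \<Longrightarrow> dist (?A p) (?A u) < e"
    using c(1)[unfolded continuous_at_eps_delta, rule_format, OF e] by (elim exE conjE) simp
  obtain d2 where d2: "d2 > 0" "\<And>p. dist p u < d2 \<Longrightarrow> dist (?B p) (?B u) < e"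
    using c(2)[unfolded continuous_at_eps_delta, rule_format, OF e] by (elim exE conjE) simp
  note d = d1 d2
  obtain d3 where d3: "d3 > 0" "ball u d3 \<subseteq> U" using assms(1,3) open_contains_ball by blast
  define d where "d = min d1 (min d2 d3)"
  \<comment> \<open>Small enough for the whole parallelogram to lie within \<open>d\<close> of
    \<open>u\<close>; the summand 1 keeps the denominator positive when \<open>v\<close> and
    \<open>w\<close> vanish.\<close>
  define h where "h = d / (norm v + norm w + 1)"
  have nn: "norm v + norm w + 1 > 0" by (smt (verit) norm_ge_zero)
  have "d > 0" using d d3 by (simp add: d_def)
  then have h: "h > 0" "h * (norm v + norm w) < d"
    using nn by (auto simp: h_def field_simps)
  have near: "dist (u + s *\<^sub>R v + t *\<^sub>R w) u < d" if "0 \<le> s" "s \<le> h" "0 \<le> t" "t \<le> h" for s t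
  proof -
    have "norm (s *\<^sub>R v + t *\<^sub>R w) \<le> s * norm v + t * norm w"
      using norm_triangle_ineq[of "s *\<^sub>R v" "t *\<^sub>R w"] that by simp
    also have "\<dots> \<le> h * norm v + h * norm w" using that by (intro add_mono mult_right_mono) auto
    finally show ?thesis using h by (simp add: dist_norm algebra_simps)
  qed
  have sub: "u + s *\<^sub>R v + t *\<^sub>R w \<in> U" if "0 \<le> s" "s \<le> h" "0 \<le> t" "t \<le> h" for s t
    using near[OF that] d3 by (auto simp: d_def dist_commute subset_iff)
  have sub': "u + s *\<^sub>R w + t *\<^sub>R v \<in> U" if "0 \<le> s" "s \<le> h" "0 \<le> t" "t \<le> h" for s t
    using sub[of t s] that by (simp add: add_ac)
  obtain s t where st: "0 \<le> s" "s \<le> h" "0 \<le> t" "t \<le> h"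
    "f (u + h *\<^sub>R v + h *\<^sub>R w) - f (u + h *\<^sub>R v) - f (u + h *\<^sub>R w) + f u
       = h * h * ?A (u + s *\<^sub>R v + t *\<^sub>R w)"
    by (rule second_difference_mvt[OF assms(1,2) h(1), of u v w]) (use sub in auto)
  obtain s' t' where st': "0 \<le> s'" "s' \<le> h" "0 \<le> t'" "t' \<le> h"
    "f (u + h *\<^sub>R w + h *\<^sub>R v) - f (u + h *\<^sub>R w) - f (u + h *\<^sub>R v) + f u
       = h * h * ?B (u + s' *\<^sub>R w + t' *\<^sub>R v)"
    by (rule second_difference_mvt[OF assms(1,2) h(1), of u w v]) (use sub' in auto)
  have "u + h *\<^sub>R w + h *\<^sub>R v = u + h *\<^sub>R v + h *\<^sub>R w" by simp
  then have "h * h * ?A (u + s *\<^sub>R v + t *\<^sub>R w) = h * h * ?B (u + s' *\<^sub>R w + t' *\<^sub>R v)"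
    using st(5) st'(5) by (simp only:)
  then have "?A (u + s *\<^sub>R v + t *\<^sub>R w) = ?B (u + s' *\<^sub>R w + t' *\<^sub>R v)" using h(1) by simp
  moreover have "dist (?A u) (?A (u + s *\<^sub>R v + t *\<^sub>R w)) < e"
    using near[OF st(1-4)] by (subst dist_commute, intro d(2)) (simp add: d_def)
  moreover have "dist (?B u) (?B (u + s' *\<^sub>R w + t' *\<^sub>R v)) < e"
    using near[OF st'(3,4,1,2)] by (subst dist_commute, intro d(4)) (simp add: d_def add_ac)
  ultimately have "dist (?A u) (?B u) < e + e"
    using dist_triangle_less_add[of "?A u" "?A (u + s *\<^sub>R v + t *\<^sub>R w)" e "?B u" e] by (simp only:)
  then show False by (simp add: e_def)
qed

lemma ddir_ddir_sym:
  fixes f :: "'a::euclidean_space \<Rightarrow> 'b::euclidean_space"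
  assumes "open U" "smooth_on U f" "u \<in> U"
  shows "ddir (\<lambda>p. ddir f p v) u w = ddir (\<lambda>p. ddir f p w) u v"
proof (rule euclidean_eqI)
  fix b :: 'b
  have 1: "ddir (\<lambda>p. ddir f p v) u w \<bullet> b = ddir (\<lambda>p. ddir (\<lambda>p. f p \<bullet> b) p v) u w" for v w
  proof -
    have "ddir (\<lambda>p. ddir f p v) u w \<bullet> b = ddir (\<lambda>p. ddir f p v \<bullet> b) u w"
      using assms by (intro bounded_linear.ddir[OF bounded_linear_inner_left, symmetric] smooth_on_ddir_const)
    also have "\<dots> = ddir (\<lambda>p. ddir (\<lambda>p. f p \<bullet> b) p v) u w"
      using assms by (intro ddir_cong[of U] bounded_linear.smooth_on[OF bounded_linear_inner_left]
          smooth_on_ddir_const bounded_linear.ddir[OF bounded_linear_inner_left, of U, symmetric])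
    finally show ?thesis .
  qed
  have "smooth_on U (\<lambda>p. f p \<bullet> b)"
    using assms by (intro bounded_linear.smooth_on[OF bounded_linear_inner_left])
  then show "ddir (\<lambda>p. ddir f p v) u w \<bullet> b = ddir (\<lambda>p. ddir f p w) u v \<bullet> b"
    unfolding 1 by (intro ddir_ddir_sym_real[OF assms(1) _ assms(3)])
qed

text \<open>By symmetry the pure second derivatives of \<open>F\<close> cancel; what remains is
  \<open>dF\<close> of the Lie bracket of \<open>G\<close> and \<open>H\<close>, written in
  coordinates.\<close>

lemma ddir_commutator:
  fixes F :: "real ^ 'n::finite \<Rightarrow> 'b::euclidean_space"
  assumes "open U" "smooth_on U F" "smooth_on U G" "smooth_on U H" "u \<in> U"
  shows "ddir (\<lambda>u. ddir F u (H u)) u (G u) - ddir (\<lambda>u. ddir F u (G u)) u (H u)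
    = ddir F u (ddir H u (G u) - ddir G u (H u))"
proof -
  have lin: "linear (ddir F u)" by (rule smooth_on_linear[OF assms(1,2,5)])
  show ?thesis
    unfolding ddir_ddir_field[OF assms(1,2,3,5), of "H u"] ddir_ddir_field[OF assms(1,2,4,5), of "G u"]
      linear_diff[OF lin] ddir_ddir_sym[OF assms(1,2,5), of "H u" "G u"]
    by (simp only: add_diff_cancel_left)
qed

section \<open>Lorentz product and bases containing two null vectors\<close>

section \<open>Lorentzian model\<close>

definition lorentz :: "'a::real_inner \<times> real \<Rightarrow> 'a \<times> real \<Rightarrow> real" where
  "lorentz p q = fst p \<bullet> fst q - snd p * snd q"

lemma lorentz_commute: "lorentz p q = lorentz q p"
  by (simp add: lorentz_def inner_commute)

lemma bounded_bilinear_lorentz: "bounded_bilinear lorentz"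
proof
  show "\<exists>K. \<forall>a b::'a \<times> real. norm (lorentz a b) \<le> norm a * norm b * K"
  proof (intro exI[of _ 2] allI)
    fix a b :: "'a \<times> real"
    have "\<bar>fst a \<bullet> fst b\<bar> \<le> norm (fst a) * norm (fst b)" by (rule Cauchy_Schwarz_ineq2)
    also have "\<dots> \<le> norm a * norm b"
      using norm_fst_le[of "fst a" "snd a"] norm_fst_le[of "fst b" "snd b"] by (intro mult_mono) auto
    finally have 1: "\<bar>fst a \<bullet> fst b\<bar> \<le> norm a * norm b" .
    have "\<bar>snd a * snd b\<bar> \<le> norm a * norm b"
      unfolding abs_mult using norm_snd_le[of "snd a" "fst a"] norm_snd_le[of "snd b" "fst b"]
      by (intro mult_mono) auto
    with 1 show "norm (lorentz a b) \<le> norm a * norm b * 2"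
      unfolding lorentz_def real_norm_def by linarith
  qed
qed (auto simp: lorentz_def inner_add_left inner_add_right algebra_simps)

interpretation lorentz: bounded_bilinear lorentz
  by (rule bounded_bilinear_lorentz)

text \<open>The functionals \<open>l m\<close> form a left inverse of the coordinate map
  \<open>A\<close>, which is therefore injective, and by the dimension count surjective. Working
  with a dual family instead of an orthonormal one serves both Lorentz bases and principal
  frames.\<close>

lemma dual_basis_expand:
  fixes e :: "'i::finite \<Rightarrow> 'a::euclidean_space" and l :: "'i \<Rightarrow> 'a \<Rightarrow> real"
  assumes card: "CARD('i) = DIM('a)"
    and lin: "\<And>m. linear (l m)" and dual: "\<And>m i. l m (e i) = (if m = i then 1 else 0)"
  shows "v = (\<Sum>m\<in>UNIV. l m v *\<^sub>R e m)"
proof -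
  define A where "A c = (\<Sum>m\<in>UNIV. c $ m *\<^sub>R e m)" for c :: "real ^ 'i"
  have A: "linear A"
    by (rule linearI) (simp_all add: A_def algebra_simps sum.distrib scaleR_sum_right)
  have l: "l m (A c) = c $ m" for m c
    by (simp add: A_def linear_sum[OF lin] linear_cmul[OF lin] dual if_distrib cong: if_cong)
  have "inj A" by (rule injI) (metis l vec_eq_iff)
  then have "dim (range A) = DIM('a)"
    using dim_image_eq[OF A, of UNIV] by (simp add: card)
  then have "span (range A) = UNIV" using dim_eq_full by blast
  moreover have "span (range A) = range A"
    using linear_subspace_image[OF A subspace_UNIV] by (simp add: span_eq_iff)
  ultimately obtain c where "v = A c" by blast
  then show ?thesis by (simp add: l) (simp add: A_def)
qed

lemma sum_UNIV_option: "(\<Sum>i\<in>UNIV. g i) = g None + (\<Sum>i\<in>UNIV. g (Some i))"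
  for g :: "'i::finite option \<Rightarrow> 'a::comm_monoid_add"
  by (simp add: UNIV_option_conv sum.reindex)

text \<open>\<open>Y\<close> and \<open>Z\<close> are null with product 1, so the dual basis is the
  basis itself with \<open>Y\<close> and \<open>Z\<close> exchanged. This exchange is the origin of
  the two mixed terms.\<close>

lemma lorentz_parseval:
  fixes y :: "'n::finite \<Rightarrow> 'v::euclidean_space \<times> real"
  assumes dim: "DIM('v) = CARD('n) + 1"
    and orth: "\<And>i j. lorentz (y i) (y j) = (if i = j then 1 else 0)"
    and Y: "lorentz Y Y = 0" "\<And>i. lorentz (y i) Y = 0"
    and Z: "lorentz Z Z = 0" "\<And>i. lorentz (y i) Z = 0" "lorentz Y Z = 1"
  shows "lorentz p q = (\<Sum>m\<in>UNIV. lorentz p (y m) * lorentz q (y m))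
    + lorentz p Y * lorentz q Z + lorentz p Z * lorentz q Y"
proof -
  \<comment> \<open>Two layers of \<open>option\<close> over the index type count the n + 2 basis
    vectors.\<close>
  define e where "e i = (case i of None \<Rightarrow> Y | Some None \<Rightarrow> Z | Some (Some m) \<Rightarrow> y m)" for i
  define e' where "e' i = (case i of None \<Rightarrow> Z | Some None \<Rightarrow> Y | Some (Some m) \<Rightarrow> y m)" for i
  have "p = (\<Sum>m\<in>UNIV. lorentz p (e' m) *\<^sub>R e m)"
  proof (rule dual_basis_expand)
    show "linear (\<lambda>p. lorentz p (e' m))" for m
      by (rule bounded_linear.linear[OF lorentz.bounded_linear_left])
    show "lorentz (e i) (e' m) = (if m = i then 1 else 0)" for m i
      using orth Y Z lorentz_commute[of Z Y] lorentz_commute[of Y "y _"] lorentz_commute[of Z "y _"]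
      by (auto simp: e_def e'_def split: option.splits)
  qed (simp add: dim)
  then have "lorentz p q = lorentz (\<Sum>m\<in>UNIV. lorentz p (e' m) *\<^sub>R e m) q"
    by (rule arg_cong)
  then have "lorentz p q = (\<Sum>m\<in>UNIV. lorentz p (e' m) * lorentz q (e m))"
    unfolding lorentz_commute[of q] by (simp only: lorentz.scaleR_left lorentz.sum_left real_scaleR_def)
  then show ?thesis
    by (simp add: sum_UNIV_option e_def e'_def)
qed

section \<open>Moving frames: connection, Codazzi and Gauss equations\<close>

locale lorentz_codazzi_frame =
  fixes U :: "(real ^ 'n::finite) set" and E :: "'n \<Rightarrow> real ^ 'n \<Rightarrow> real ^ 'n"
    and Y \<eta> :: "real ^ 'n \<Rightarrow> 'v::euclidean_space \<times> real" and Z :: "real ^ 'n \<Rightarrow> 'v \<times> real"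
    and b :: "'n \<Rightarrow> real" and lam :: real
  assumes open_U: "open U" and smooth_E: "\<And>i. smooth_on U (E i)"
    and smooth_Y: "smooth_on U Y" and smooth_eta: "smooth_on U \<eta>"
    and null: "\<And>u. u \<in> U \<Longrightarrow> lorentz (Y u) (Y u) = 0"
    and orth: "\<And>u i j. u \<in> U \<Longrightarrow>
      lorentz (ddir Y u (E i u)) (ddir Y u (E j u)) = (if i = j then 1 else 0)"
    and eta: "\<And>u i. u \<in> U \<Longrightarrow> ddir \<eta> u (E i u) = b i *\<^sub>R ddir Y u (E i u)"
    and parseval: "\<And>u p q. u \<in> U \<Longrightarrow> lorentz p q =
      (\<Sum>m\<in>UNIV. lorentz p (ddir Y u (E m u)) * lorentz q (ddir Y u (E m u)))
        + lorentz p (Y u) * lorentz q (Z u) + lorentz p (Z u) * lorentz q (Y u)"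
    and isotropic: "\<And>u k l. u \<in> U \<Longrightarrow>
      lorentz (ddir (\<lambda>w. ddir Y w (E l w)) u (E k u)) (Z u) = (if k = l then lam else 0)"
begin

definition y :: "'n \<Rightarrow> real ^ 'n \<Rightarrow> 'v \<times> real" where
  "y i u = ddir Y u (E i u)"

definition D :: "'n \<Rightarrow> (real ^ 'n \<Rightarrow> 'v \<times> real) \<Rightarrow> real ^ 'n \<Rightarrow> 'v \<times> real" where
  "D k F u = ddir F u (E k u)"

text \<open>Connection coefficients of the metric induced by \<open>Y\<close>: the tangential part
  of \<open>D k (y l)\<close> is \<open>dY\<close> of the covariant derivative of \<open>E l\<close>
  along \<open>E k\<close>, and \<open>W u k l m\<close> is its component along
  \<open>E m\<close>.\<close>

definition W :: "real ^ 'n \<Rightarrow> 'n \<Rightarrow> 'n \<Rightarrow> 'n \<Rightarrow> real" where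
  "W u k l m = lorentz (D k (y l) u) (y m u)"

definition bracket :: "'n \<Rightarrow> 'n \<Rightarrow> real ^ 'n \<Rightarrow> real ^ 'n" where
  "bracket k l u = ddir (E l) u (E k u) - ddir (E k) u (E l u)"

lemma smooth_D: "smooth_on U F \<Longrightarrow> smooth_on U (D k F)"
  unfolding D_def by (intro smooth_on_ddir open_U smooth_E)

lemma smooth_y: "smooth_on U (y i)"
  using smooth_D[OF smooth_Y, of i] unfolding D_def y_def .

lemma ddir_lorentz_const:
  assumes "smooth_on U F" "smooth_on U G" "\<And>u. u \<in> U \<Longrightarrow> lorentz (F u) (G u) = c" "u \<in> U"
  shows "lorentz (F u) (D k G u) + lorentz (D k F u) (G u) = 0"
proof -
  have "ddir (\<lambda>u. lorentz (F u) (G u)) u v = ddir (\<lambda>u. c) u v" for v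
    using assms by (intro ddir_cong[OF open_U] lorentz.smooth_on open_U)
  then show ?thesis
    unfolding D_def using lorentz.ddir[OF open_U assms(1,2,4)] by simp
qed

lemma commutator:
  "smooth_on U F \<Longrightarrow> u \<in> U \<Longrightarrow> D k (D l F) u - D l (D k F) u = ddir F u (bracket k l u)"
  unfolding D_def[abs_def] bracket_def by (rule ddir_commutator[OF open_U _ smooth_E smooth_E])

lemma lorentz_Y_y: "u \<in> U \<Longrightarrow> lorentz (y k u) (Y u) = 0"
  using ddir_lorentz_const[OF smooth_Y smooth_Y null, of u k]
  by (simp add: D_def y_def lorentz_commute)

text \<open>Differentiating \<open>lorentz (y l u) (Y u) = 0\<close> along \<open>E k\<close> moves
  the derivative onto \<open>Y\<close> and leaves minus the product of \<open>y l\<close> and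
  \<open>y k\<close>.\<close>

lemma lorentz_Dy_Y: "u \<in> U \<Longrightarrow> lorentz (D k (y l) u) (Y u) = (if k = l then -1 else 0)"
  using ddir_lorentz_const[OF smooth_y smooth_Y lorentz_Y_y, of u l k] orth[of u l k]
  by (auto simp: D_def y_def[abs_def] split: if_splits)

lemma W_antisym: "u \<in> U \<Longrightarrow> W u k m l = - W u k l m"
  using ddir_lorentz_const[OF smooth_y smooth_y, of l m _ u k] orth
  by (fastforce simp: W_def y_def lorentz_commute)

lemma W_diag: "u \<in> U \<Longrightarrow> W u k l l = 0"
  using W_antisym[of u k l l] by simp

text \<open>The connection is torsion free: \<open>dY\<close> of the bracket is
  \<open>D k (y l) - D l (y k)\<close>, and its components are read off by pairing with the
  orthonormal \<open>y m\<close>.\<close>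

lemma bracket_expand:
  assumes "u \<in> U"
  shows "bracket k l u = (\<Sum>m\<in>UNIV. (W u k l m - W u l k m) *\<^sub>R E m u)"
proof -
  have "linear (\<lambda>v. lorentz (ddir Y u v) (y m u))" for m
    using smooth_on_linear[OF open_U smooth_Y assms]
      bounded_linear.linear[OF lorentz.bounded_linear_left[of "y m u"]]
    by (rule linear_compose[unfolded o_def])
  then have "bracket k l u = (\<Sum>m\<in>UNIV. lorentz (ddir Y u (bracket k l u)) (y m u) *\<^sub>R E m u)"
    by (rule dual_basis_expand[rotated]) (simp_all add: y_def orth[OF assms])
  moreover have "ddir Y u (bracket k l u) = D k (y l) u - D l (y k) u"
    using commutator[OF smooth_Y assms, of k l] by (simp add: y_def[abs_def] D_def[abs_def])
  ultimately show ?thesis by (simp add: W_def lorentz.diff_left)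
qed

lemma ddir_bracket:
  assumes "u \<in> U" "smooth_on U F"
  shows "ddir F u (bracket k l u) = (\<Sum>m\<in>UNIV. (W u k l m - W u l k m) *\<^sub>R D m F u)"
  using smooth_on_linear[OF open_U assms(2,1)]
  by (simp add: bracket_expand[OF assms(1)] linear_sum linear_cmul D_def)

text \<open>\<open>(b l - b m) * W u k l m\<close> is a component of the covariant derivative of the
  second fundamental form, because \<open>b\<close> is constant; the identity is its symmetry in
  \<open>k\<close> and \<open>l\<close>. It results from evaluating the commutator of
  \<open>D k\<close> and \<open>D l\<close> on \<open>\<eta>\<close> in two ways and pairing with
  \<open>y m\<close>.\<close>

lemma codazzi:
  assumes "u \<in> U"
  shows "(b l - b m) * W u k l m = (b k - b m) * W u l k m"
proof -
  have D_eta: "D k (D l \<eta>) u = b l *\<^sub>R D k (y l) u" for k l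
  proof -
    have "ddir (D l \<eta>) u v = ddir (\<lambda>u. b l *\<^sub>R y l u) u v" for v
      using assms by (intro ddir_cong[OF open_U] smooth_D smooth_eta assms) (simp add: D_def y_def eta)
    then show ?thesis
      unfolding D_def using bounded_linear.ddir[OF bounded_linear_scaleR_right open_U smooth_y assms] by metis
  qed
  have "b l *\<^sub>R D k (y l) u - b k *\<^sub>R D l (y k) u = (\<Sum>i\<in>UNIV. (W u k l i - W u l k i) *\<^sub>R D i \<eta> u)"
    using commutator[OF smooth_eta assms, of k l] ddir_bracket[OF assms smooth_eta, of k l] by (simp add: D_eta)
  then have "lorentz (b l *\<^sub>R D k (y l) u - b k *\<^sub>R D l (y k) u) (y m u)
      = (\<Sum>i\<in>UNIV. (W u k l i - W u l k i) * b i * (if i = m then 1 else 0))"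
    using assms by (simp add: lorentz.sum_left lorentz.scaleR_left D_def eta y_def orth)
  also have "\<dots> = (W u k l m - W u l k m) * b m"
    by (simp add: if_distrib cong: if_cong)
  finally show ?thesis
    by (simp add: lorentz.diff_left lorentz.scaleR_left W_def algebra_simps)
qed

text \<open>The Codazzi equation with a repeated index has a vanishing right-hand side. Since the
  \<open>b i\<close> are distinct, the integral curves of each \<open>E k\<close> are
  geodesics.\<close>

lemma W_self:
  assumes "inj b" "u \<in> U"
  shows "W u k k m = 0"
proof (cases "m = k")
  case False
  then have "b k - b m \<noteq> 0" using assms(1) by (auto dest: injD)
  moreover have "(b k - b m) * W u k m k = 0"
    using codazzi[OF assms(2), of m k k] by (auto simp: W_diag[OF assms(2)])
  ultimately show ?thesis using W_antisym[OF assms(2), of k k m] by simp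
qed (simp add: W_diag[OF assms(2)])

text \<open>Flatness of Lorentz space enters as the commutator formula for \<open>y i\<close>,
  paired with \<open>y j\<close>. The left-hand side gathers connection coefficients, while the null
  directions \<open>Y\<close> and \<open>Z\<close> contribute the curvature term.\<close>

lemma gauss:
  assumes "inj b" "u \<in> U" "i \<noteq> j"
  shows "(\<Sum>m\<in>UNIV. (W u i j m - W u j i m) * W u m i j + W u j i m * W u i j m) = - 2 * lam"
proof -
  note u = assms(2)
  have iso: "lorentz (D k (y l) u) (Z u) = (if k = l then lam else 0)" for k l
    using isotropic[OF u] by (simp add: D_def y_def[abs_def])
  \<comment> \<open>Parseval splits each derivative into its tangential components and its products
    with \<open>Y\<close> (equal to -1 or 0) and \<open>Z\<close> (equal to \<open>lam\<close> or
    0).\<close>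
  have pv: "lorentz (D k (y l) u) (D k' (y l') u) = (\<Sum>m\<in>UNIV. W u k l m * W u k' l' m)
      + (if k = l then -1 else 0) * (if k' = l' then lam else 0)
      + (if k = l then lam else 0) * (if k' = l' then -1 else 0)" for k l k' l'
    using parseval[OF u, of "D k (y l) u" "D k' (y l') u"]
    by (simp only: y_def[symmetric] W_def iso lorentz_Dy_Y[OF u])
  \<comment> \<open>Both products vanish on all of \<open>U\<close>, hence may be differentiated;
    this trades second derivatives of \<open>y i\<close> for products of first derivatives.\<close>
  have z1: "lorentz (D j (y i) u) (y j u) = 0" "lorentz (D i (y i) u) (y j u) = 0" if "u \<in> U" for u
    using W_self[OF assms(1) that, of j i] W_antisym[OF that, of j i j] W_self[OF assms(1) that, of i j]
    by (simp_all add: W_def)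
  have 1: "lorentz (D j (y i) u) (D i (y j) u) + lorentz (D i (D j (y i)) u) (y j u) = 0"
    by (rule ddir_lorentz_const[OF _ _ z1(1) u]) (auto intro: smooth_D smooth_y)
  have 2: "lorentz (D i (y i) u) (D j (y j) u) + lorentz (D j (D i (y i)) u) (y j u) = 0"
    by (rule ddir_lorentz_const[OF _ _ z1(2) u]) (auto intro: smooth_D smooth_y)
  have "D i (D j (y i)) u - D j (D i (y i)) u = (\<Sum>m\<in>UNIV. (W u i j m - W u j i m) *\<^sub>R D m (y i) u)"
    using commutator[OF smooth_y u] ddir_bracket[OF u smooth_y] by simp
  then have "lorentz (D i (D j (y i)) u - D j (D i (y i)) u) (y j u)
      = (\<Sum>m\<in>UNIV. (W u i j m - W u j i m) * W u m i j)"
    by (simp add: lorentz.sum_left lorentz.scaleR_left W_def)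
  then have "(\<Sum>m\<in>UNIV. (W u i j m - W u j i m) * W u m i j)
      = lorentz (D i (y i) u) (D j (y j) u) - lorentz (D j (y i) u) (D i (y j) u)"
    using 1 2 by (simp add: lorentz.diff_left)
  also have "\<dots> = - 2 * lam - (\<Sum>m\<in>UNIV. W u j i m * W u i j m)"
    unfolding pv using assms(3) by (simp add: W_self[OF assms(1) u])
  finally show ?thesis by (simp add: sum.distrib)
qed

text \<open>By the Codazzi equation the three coefficients in \<open>q m\<close> are one number
  \<open>B\<close> divided by \<open>b j - b m\<close>, \<open>b i - b m\<close> and
  \<open>b i - b j\<close>. Hence \<open>q m\<close> is
  \<open>2 * B\<^sup>2 / ((b i - b m) * (b j - b m))\<close> for \<open>m\<close> other than
  \<open>i\<close>, \<open>j\<close>, stated here without division.\<close>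

lemma gauss_summand:
  assumes "inj b" "u \<in> U" "i \<noteq> j"
  defines "q \<equiv> \<lambda>m. (W u i j m - W u j i m) * W u m i j + W u j i m * W u i j m"
  shows "m = i \<or> m = j \<Longrightarrow> q m = 0"
    and "(b i - b m) * (b j - b m) * q m = 2 * ((b j - b m) * W u i j m)\<^sup>2"
proof -
  note u = assms(2)
  have 0: "W u i j j = 0" "W u j i i = 0" "W u i j i = 0" "W u j i j = 0"
    using W_diag[OF u] W_self[OF assms(1) u] W_antisym[OF u, of i j i] W_antisym[OF u, of j i j] by auto
  then show "q m = 0" if "m = i \<or> m = j"
    using that by (auto simp: q_def)
  define B where "B = (b j - b m) * W u i j m"
  have B1: "(b i - b m) * W u j i m = B" using codazzi[OF u, of j m i] by (simp add: B_def)
  have B2: "(b i - b j) * W u m i j = B"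
    using codazzi[OF u, of i j m] W_antisym[OF u, of i j m] by (simp add: B_def algebra_simps)
  have ne: "b i - b j \<noteq> 0" using assms(1,3) by (auto dest: injD)
  \<comment> \<open>The extra factor \<open>b i - b j\<close> lets every coefficient meet its own
    difference, so that each such product becomes \<open>B\<close>; it is cancelled at the
    end.\<close>
  have "(b i - b j) * ((b i - b m) * (b j - b m) * q m) =
      ((b i - b m) * ((b j - b m) * W u i j m) - (b j - b m) * ((b i - b m) * W u j i m)) * ((b i - b j) * W u m i j)
      + (b i - b j) * ((b i - b m) * W u j i m) * ((b j - b m) * W u i j m)"
    unfolding q_def by (simp add: algebra_simps)
  also have "\<dots> = (b i - b j) * (2 * B\<^sup>2)"
    unfolding B1 B2 B_def[symmetric] by (simp add: algebra_simps power2_eq_square)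
  finally show "(b i - b m) * (b j - b m) * q m = 2 * ((b j - b m) * W u i j m)\<^sup>2"
    using ne by (simp add: B_def)
qed

lemma lam_eq_0:
  assumes "inj b" "u \<in> U" "CARD('n) \<ge> 2"
  shows "lam = 0"
proof -
  define q where "q i j m = (W u i j m - W u j i m) * W u m i j + W u j i m * W u i j m" for i j m
  have q: "(\<Sum>m\<in>UNIV. q i j m) = - 2 * lam" "m = i \<or> m = j \<Longrightarrow> q i j m = 0"
    "(b i - b m) * (b j - b m) * q i j m \<ge> 0" if "i \<noteq> j" for i j m
    using gauss[OF assms(1,2) that] gauss_summand[OF assms(1,2) that] by (simp_all add: q_def)
  have ex: "\<exists>i\<in>S. \<forall>m\<in>S. g m \<le> g i" if "S \<noteq> {}" for S :: "'n set" and g :: "'n \<Rightarrow> real"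
    using finite_imageI[OF finite, of g S] Max_in[of "g ` S"] Max_ge[of "g ` S"] that by fastforce
  obtain i where i: "\<And>m. b m \<le> b i" using ex[of UNIV b] by auto
  have "UNIV - {i} \<noteq> {}"
  proof
    assume "UNIV - {i} = {}"
    then have "UNIV = {i}" by blast
    then have "CARD('n) = 1" by (metis card.empty card_insert_disjoint empty_iff finite.emptyI One_nat_def)
    then show False using assms(3) by simp
  qed
  then obtain j where j: "j \<noteq> i" "\<And>m. m \<noteq> i \<Longrightarrow> b m \<le> b j"
    using ex[of "UNIV - {i}" b] by auto
  obtain j' where j': "j' \<noteq> i" "\<And>m. m \<noteq> i \<Longrightarrow> b j' \<le> b m"
    using ex[OF \<open>UNIV - {i} \<noteq> {}\<close>, of "\<lambda>m. - b m"] by auto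
  have lt: "b m < b n" if "b m \<le> b n" "m \<noteq> n" for m n
    using that assms(1) by (metis injD order_le_less)
  \<comment> \<open>With \<open>b i\<close> the largest and \<open>b j\<close> the second largest
    value, both differences are positive for every other \<open>m\<close>.\<close>
  have "q i j m \<ge> 0" for m
  proof (cases "m = i \<or> m = j")
    case False
    then have "(b i - b m) * (b j - b m) > 0" using lt[of m i] lt[of m j] i j by simp
    then show ?thesis using q(3)[of i j m] j(1) by (auto simp: zero_le_mult_iff)
  qed (use q(2) j(1) in auto)
  then have "- 2 * lam \<ge> 0" using q(1)[of i j] j(1) sum_nonneg[of UNIV "q i j"] by simp
  \<comment> \<open>With \<open>b j'\<close> the smallest value, the two differences have opposite
    signs for every other \<open>m\<close>.\<close>
  moreover have "q i j' m \<le> 0" for m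
  proof (cases "m = i \<or> m = j'")
    case False
    then have "(b i - b m) * (b j' - b m) < 0"
      using lt[of m i] lt[of j' m] i j' by (auto simp: mult_less_0_iff)
    from mult_neg_pos[OF this, of "q i j' m"] show ?thesis
      using q(3)[OF j'(1)[symmetric], of m] by (meson not_le)
  qed (use q(2) j'(1) in auto)
  then have "- 2 * lam \<le> 0" using q(1)[of i j'] j'(1) sum_nonpos[of UNIV "q i j'"] by simp
  ultimately show ?thesis by simp
qed

end

section \<open>Smooth determinants, inverses and spectral projections\<close>

section \<open>Smooth matrix fields\<close>

definition smooth_matrix_on :: "'a::euclidean_space set \<Rightarrow> ('a \<Rightarrow> real ^ 'n ^ 'm) \<Rightarrow> bool" where
  "smooth_matrix_on U A \<longleftrightarrow> (\<forall>i j. smooth_on U (\<lambda>u. A u $ i $ j))"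

lemma smooth_matrix_onD: "smooth_matrix_on U A \<Longrightarrow> smooth_on U (\<lambda>u. A u $ i $ j)"
  by (simp add: smooth_matrix_on_def)

lemma smooth_matrix_on_const: "smooth_matrix_on U (\<lambda>u. A)"
  by (simp add: smooth_matrix_on_def smooth_on_const)

lemma smooth_matrix_on_diff:
  "open U \<Longrightarrow> smooth_matrix_on U A \<Longrightarrow> smooth_matrix_on U B \<Longrightarrow> smooth_matrix_on U (\<lambda>u. A u - B u)"
  by (simp add: smooth_matrix_on_def smooth_on_diff)

lemma smooth_matrix_on_scaleR:
  "open U \<Longrightarrow> smooth_on U c \<Longrightarrow> smooth_matrix_on U A \<Longrightarrow> smooth_matrix_on U (\<lambda>u. c u *\<^sub>R A u)"
  by (simp add: smooth_matrix_on_def smooth_on_mult)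

lemma smooth_matrix_on_mult:
  assumes "open U" "smooth_matrix_on U A" "smooth_matrix_on U B"
  shows "smooth_matrix_on U (\<lambda>u. A u ** B u)"
  unfolding smooth_matrix_on_def matrix_matrix_mult_def vec_lambda_beta
  by (intro allI smooth_on_sum smooth_on_mult smooth_matrix_onD assms)

lemma smooth_on_matrix_vector_mult:
  assumes "open U" "smooth_matrix_on U A"
  shows "smooth_on U (\<lambda>u. A u *v v)"
  unfolding matrix_vector_mult_def
  by (intro smooth_on_vec_lambda smooth_on_sum smooth_on_mult smooth_matrix_onD smooth_on_const assms)

lemma smooth_on_trace:
  assumes "open U" "smooth_matrix_on U A"
  shows "smooth_on U (\<lambda>u. trace (A u))"
  unfolding trace_def by (intro smooth_on_sum smooth_matrix_onD assms)

lemma smooth_on_det: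
  fixes A :: "'a::euclidean_space \<Rightarrow> real ^ 'n ^ 'n"
  assumes "open U" "smooth_matrix_on U A"
  shows "smooth_on U (\<lambda>u. det (A u))"
  unfolding det_def by (intro smooth_on_sum smooth_on_mult smooth_on_prod smooth_matrix_onD smooth_on_const assms)

lemma matrix_inv_mult:
  fixes A :: "real ^ 'n ^ 'n"
  assumes "det A \<noteq> 0"
  shows "A ** matrix_inv A = mat 1" "matrix_inv A ** A = mat 1"
proof -
  have "\<exists>B. A ** B = mat 1 \<and> B ** A = mat 1"
    using assms by (simp add: invertible_det_nz[symmetric] invertible_def)
  then have "A ** matrix_inv A = mat 1 \<and> matrix_inv A ** A = mat 1"
    unfolding matrix_inv_def by (rule someI_ex)
  then show "A ** matrix_inv A = mat 1" "matrix_inv A ** A = mat 1" by blast+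
qed

text \<open>Cramer's rule writes every entry of the inverse as a quotient of determinants of smooth
  matrices.\<close>

lemma smooth_matrix_on_inverse:
  fixes A :: "'a::euclidean_space \<Rightarrow> real ^ 'n ^ 'n"
  assumes "open U" "smooth_matrix_on U A" and nz: "\<And>u. u \<in> U \<Longrightarrow> det (A u) \<noteq> 0"
  shows "smooth_matrix_on U (\<lambda>u. matrix_inv (A u))"
  unfolding smooth_matrix_on_def
proof (intro allI)
  fix k l
  \<comment> \<open>\<open>A u\<close> with column \<open>k\<close> replaced by the
    \<open>l\<close>-th standard vector, as in Cramer's rule for column \<open>l\<close> of the
    inverse.\<close>
  let ?M = "\<lambda>u. \<chi> i j. if j = k then axis l 1 $ i else A u $ i $ j"
  have "smooth_matrix_on U ?M"
    unfolding smooth_matrix_on_def vec_lambda_beta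
  proof (intro allI)
    show "smooth_on U (\<lambda>u. if j = k then axis l 1 $ i else A u $ i $ j)" for i j
      using assms(2) by (cases "j = k") (simp_all add: smooth_on_const smooth_matrix_onD)
  qed
  then have sm: "smooth_on U (\<lambda>u. det (?M u) / det (A u))"
    using assms by (intro smooth_on_divide smooth_on_det)
  have "det (?M u) / det (A u) = matrix_inv (A u) $ k $ l" if "u \<in> U" for u
  proof -
    have "A u ** matrix_inv (A u) = mat 1"
      by (rule matrix_inv_mult[OF nz[OF that]])
    then have "A u *v (matrix_inv (A u) *v axis l 1) = axis l 1"
      by (simp add: matrix_vector_mul_assoc)
    then have "matrix_inv (A u) *v axis l 1 = (\<chi> k. det (\<chi> i j. if j = k then axis l 1 $ i else A u $ i $ j) / det (A u))"
      using cramer[OF nz[OF that]] by blast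
    then have "(matrix_inv (A u) *v axis l 1) $ k = det (?M u) / det (A u)" by simp
    then show ?thesis
      by (simp add: matrix_vector_mult_basis column_def)
  qed
  with sm show "smooth_on U (\<lambda>u. matrix_inv (A u) $ k $ l)"
    using smooth_on_cong[OF assms(1), of "\<lambda>u. det (?M u) / det (A u)" "\<lambda>u. matrix_inv (A u) $ k $ l"]
    by blast
qed

text \<open>Expands each standard basis vector in the eigenbasis and exchanges the sums. It turns
  symmetric sums of eigenvalues, known only point by point, into traces of smooth matrices.\<close>

lemma trace_eigenbasis:
  fixes A :: "real ^ 'n ^ 'n" and l :: "'n \<Rightarrow> real ^ 'n \<Rightarrow> real"
  assumes lin: "\<And>m. linear (l m)" and dual: "\<And>m i. l m (e i) = (if m = i then 1 else 0)"
    and eig: "\<And>i. A *v e i = c i *\<^sub>R e i"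
  shows "trace A = (\<Sum>i\<in>UNIV. c i)"
proof -
  have "A $ a $ a = (\<Sum>m\<in>UNIV. c m * (l m (axis a 1) * e m $ a))" for a
  proof -
    have "A *v axis a 1 = A *v (\<Sum>m\<in>UNIV. l m (axis a 1) *\<^sub>R e m)"
      by (intro arg_cong[of _ _ "\<lambda>v. A *v v"] dual_basis_expand lin dual) simp
    also have "\<dots> = (\<Sum>m\<in>UNIV. l m (axis a 1) *\<^sub>R (c m *\<^sub>R e m))"
      by (simp add: linear_sum[OF matrix_vector_mul_linear] linear_cmul[OF matrix_vector_mul_linear] eig)
    finally have "(A *v axis a 1) $ a = (\<Sum>m\<in>UNIV. l m (axis a 1) *\<^sub>R (c m *\<^sub>R e m)) $ a" by simp
    then show ?thesis by (simp add: matrix_vector_mult_basis column_def mult_ac)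
  qed
  then have "trace A = (\<Sum>a\<in>UNIV. \<Sum>m\<in>UNIV. c m * (l m (axis a 1) * e m $ a))"
    by (simp add: trace_def)
  also have "\<dots> = (\<Sum>m\<in>UNIV. c m * (\<Sum>a\<in>UNIV. l m (axis a 1) * e m $ a))"
    by (subst sum.swap) (simp add: sum_distrib_left)
  also have "\<dots> = (\<Sum>m\<in>UNIV. c m)"
  proof (intro sum.cong refl)
    fix m
    have "(\<Sum>a\<in>UNIV. l m (axis a 1) * e m $ a) = 1"
    using linear_expand_axis[OF lin, of m "e m"] dual[of m m] by (simp add: mult.commute)
    then show "c m * (\<Sum>a\<in>UNIV. l m (axis a 1) * e m $ a) = c m" by simp
  qed
  finally show ?thesis .
qed

text \<open>When \<open>b\<close> lists the eigenvalues of \<open>A\<close> and \<open>J\<close> omits one of them, \<open>Q\<close> is, up to a nonzero factor,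
  the projection onto its eigenspace.\<close>

lemma smooth_annihilator:
  fixes A :: "'a::euclidean_space \<Rightarrow> real ^ 'n ^ 'n"
  assumes "open U" "smooth_matrix_on U A" "finite J"
  shows "\<exists>Q. smooth_matrix_on U Q \<and>
    (\<forall>u v c. A u *v v = c *\<^sub>R v \<longrightarrow> Q u *v v = (\<Prod>j\<in>J. c - b j) *\<^sub>R v)"
  using assms(3)
proof induction
  case empty
  show ?case by (intro exI[of _ "\<lambda>u. mat 1"]) (simp add: smooth_matrix_on_const)
next
  case (insert j J)
  then obtain Q where Q: "smooth_matrix_on U Q"
    "\<And>u v c. A u *v v = c *\<^sub>R v \<Longrightarrow> Q u *v v = (\<Prod>j\<in>J. c - b j) *\<^sub>R v" by auto
  let ?Q = "\<lambda>u. (A u - b j *\<^sub>R mat 1) ** Q u"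
  have "?Q u *v v = (\<Prod>j\<in>insert j J. c - b j) *\<^sub>R v" if "A u *v v = c *\<^sub>R v" for u v c
  proof -
    have "?Q u *v v = (A u - b j *\<^sub>R mat 1) *v ((\<Prod>j\<in>J. c - b j) *\<^sub>R v)"
      by (simp add: matrix_vector_mul_assoc[symmetric] Q(2)[OF that])
    also have "\<dots> = (\<Prod>j\<in>J. c - b j) *\<^sub>R (c *\<^sub>R v - b j *\<^sub>R v)"
      by (simp add: linear_cmul[OF matrix_vector_mul_linear] matrix_vector_mult_diff_rdistrib
          scaleR_matrix_vector_assoc[symmetric] that)
    finally show ?thesis using insert(1,2) by (simp add: algebra_simps)
  qed
  then show ?case
    using Q(1) assms(1,2)
    by (intro exI[of _ ?Q]) (auto intro!: smooth_matrix_on_mult smooth_matrix_on_diff smooth_matrix_on_const)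
qed

section \<open>Third fundamental form, radii of curvature and principal frames in a chart\<close>

section \<open>Hypersurfaces in local coordinates\<close>

text \<open>Gives second derivatives the double-sum shape of \<open>Hess_III\<close>. Only the outer
  direction expands by linearity of the derivative; symmetry brings the other one into that
  position.\<close>

lemma second_ddir_expand:
  fixes F :: "real ^ 'n::finite \<Rightarrow> 'b::euclidean_space"
  assumes "open U" "smooth_on U F" "u \<in> U"
  shows "ddir (\<lambda>p. ddir F p w) u v =
    (\<Sum>a\<in>UNIV. \<Sum>b\<in>UNIV. (v $ a * w $ b) *\<^sub>R ddir (\<lambda>p. ddir F p (axis b 1)) u (axis a 1))"
proof -
  have e: "ddir (\<lambda>p. ddir F p w) u v = (\<Sum>a\<in>UNIV. v $ a *\<^sub>R ddir (\<lambda>p. ddir F p w) u (axis a 1))" for v w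
    using assms by (intro ddir_expand smooth_on_ddir_const)
  have "ddir (\<lambda>p. ddir F p w) u (axis a 1)
      = (\<Sum>b\<in>UNIV. w $ b *\<^sub>R ddir (\<lambda>p. ddir F p (axis b 1)) u (axis a 1))" for a
    using e[of "axis a 1" w] ddir_ddir_sym[OF assms, of w "axis a 1"]
      ddir_ddir_sym[OF assms, of "axis _ 1" "axis a 1"] by simp
  then show ?thesis
    unfolding e[of w v] by (simp add: scaleR_sum_right)
qed

text \<open>Frames and curvatures are given point by point, with no smoothness of \<open>k\<close>
  assumed; smoothness of the mean radius and of \<open>rho\<close> is derived from matrix
  fields.\<close>

locale hypersurface_chart =
  fixes U :: "(real ^ 'n::finite) set" and X N :: "real ^ 'n \<Rightarrow> real ^ 'm::finite"
    and k :: "real ^ 'n \<Rightarrow> 'n \<Rightarrow> real"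
  assumes open_U: "open U" and smooth_X: "smooth_on U X" and smooth_N: "smooth_on U N"
    and unit: "\<And>u. u \<in> U \<Longrightarrow> N u \<bullet> N u = 1"
    and frame: "\<And>u. u \<in> U \<Longrightarrow> \<exists>e. principal_frame X N k u e"
    and k_nz: "\<And>u i. u \<in> U \<Longrightarrow> k u i \<noteq> 0"
    and not_umbilic: "\<And>u. u \<in> U \<Longrightarrow> \<not> umbilic k u"
begin

abbreviation "R \<equiv> mean_radius k"

abbreviation "T \<equiv> third_mat N"

text \<open>The coordinate matrix of the inverse shape operator, as \<open>III\<close> inverse times
  the second fundamental form; its eigenvalues are the radii of curvature.\<close>

definition shape_inverse :: "real ^ 'n \<Rightarrow> real ^ 'n ^ 'n" where
  "shape_inverse u = matrix_inv (T u) ** (\<chi> a b. - (ddir N u (axis a 1) \<bullet> ddir X u (axis b 1)))"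

lemma N_ddir: "u \<in> U \<Longrightarrow> N u \<bullet> ddir N u v = 0"
proof -
  assume u: "u \<in> U"
  have "ddir (\<lambda>u. N u \<bullet> N u) u v = ddir (\<lambda>u. 1) u v"
    using u by (intro ddir_cong[OF open_U] smooth_on_inner open_U smooth_N unit)
  then show ?thesis
    using bounded_bilinear.ddir[OF bounded_bilinear_inner open_U smooth_N smooth_N u] by (simp add: inner_commute)
qed

lemmas linear_N = smooth_on_linear[OF open_U smooth_N]
lemmas linear_X = smooth_on_linear[OF open_U smooth_X]

context
  fixes u e assumes u: "u \<in> U" and e: "principal_frame X N k u e"
begin

lemma linear_coordinate: "linear (\<lambda>v. ddir X u v \<bullet> ddir X u (e m))"
  using linear_compose[OF linear_X[OF u] bounded_linear.linear[OF bounded_linear_inner_left]]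
  by (simp add: o_def)

lemma coordinate_dual: "ddir X u (e i) \<bullet> ddir X u (e m) = (if m = i then 1 else 0)"
  using e by (auto simp: principal_frame_def)

lemma frame_expand: "v = (\<Sum>m\<in>UNIV. (ddir X u v \<bullet> ddir X u (e m)) *\<^sub>R e m)"
  by (rule dual_basis_expand[OF _ linear_coordinate coordinate_dual]) simp

lemma ddir_X_e: "ddir X u (e i) = - radius k i u *\<^sub>R ddir N u (e i)"
  using e k_nz[OF u] by (simp add: principal_frame_def radius_def)

lemma e_nz: "e i \<noteq> 0"
  using coordinate_dual[of i i] linear_0[OF linear_X[OF u]] by auto

lemma ddir_N_frame: "ddir N u (e i) \<bullet> ddir N u (e j) = (if i = j then (k u i)\<^sup>2 else 0)"
  using e by (auto simp: principal_frame_def power2_eq_square)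

end

text \<open>In a principal frame \<open>dN\<close> scales each direction by a nonzero curvature. So
  the Gauss map is an immersion and \<open>III\<close> is nondegenerate.\<close>

lemma ddir_N_eq_0:
  assumes "u \<in> U" "ddir N u v = 0"
  shows "v = 0"
proof -
  obtain e where e: "principal_frame X N k u e" using frame[OF assms(1)] by (elim exE)
  have "ddir X u v \<bullet> ddir X u (e m) = 0" for m
  proof -
    have N_v: "ddir N u v = (\<Sum>i\<in>UNIV. (ddir X u v \<bullet> ddir X u (e i)) *\<^sub>R ddir N u (e i))"
      by (subst frame_expand[OF assms(1) e, of v])
        (simp only: linear_sum[OF linear_N[OF assms(1)]] linear_cmul[OF linear_N[OF assms(1)]])
    then have "0 = ddir N u v \<bullet> ddir N u (e m)" using assms(2) by simp
    also have "\<dots> = (ddir X u v \<bullet> ddir X u (e m)) * (k u m)\<^sup>2"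
      unfolding N_v
      by (simp add: inner_sum_left ddir_N_frame[OF assms(1) e] if_distrib cong: if_cong)
    finally show ?thesis using k_nz[OF assms(1)] by simp
  qed
  then show ?thesis using frame_expand[OF assms(1) e, of v] by simp
qed

lemma T_mult:
  assumes "u \<in> U"
  shows "w \<bullet> (T u *v v) = ddir N u w \<bullet> ddir N u v"
proof -
  have "w \<bullet> (T u *v v)
      = (\<Sum>a\<in>UNIV. \<Sum>b\<in>UNIV. w $ a * (v $ b * (ddir N u (axis a 1) \<bullet> ddir N u (axis b 1))))"
    unfolding inner_vec_def[of w]
    by (simp add: third_mat_def third_form_def matrix_vector_mult_def sum_distrib_left mult.commute)
  also have "\<dots> = ddir N u w \<bullet> ddir N u v"
    unfolding ddir_expand[OF open_U smooth_N assms, of v] ddir_expand[OF open_U smooth_N assms, of w]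
    by (subst sum.swap) (simp add: inner_sum_left inner_sum_right sum_distrib_left mult.left_commute)
  finally show ?thesis .
qed

lemma T_det: "u \<in> U \<Longrightarrow> det (T u) \<noteq> 0"
proof -
  assume u: "u \<in> U"
  have "v = 0" if "T u *v v = 0" for v
    using T_mult[OF u, of v v] ddir_N_eq_0[OF u, of v] that by simp
  then have "invertible (T u)"
    unfolding invertible_left_inverse matrix_left_invertible_ker by blast
  then show ?thesis by (simp add: invertible_det_nz)
qed

lemma T_inv: "u \<in> U \<Longrightarrow> T u ** matrix_inv (T u) = mat 1" "u \<in> U \<Longrightarrow> matrix_inv (T u) ** T u = mat 1"
  using matrix_inv_mult[OF T_det] by blast+

lemma smooth_T: "smooth_matrix_on U T"
  unfolding smooth_matrix_on_def third_mat_def third_form_def vec_lambda_beta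
  by (intro allI smooth_on_inner smooth_on_ddir_const smooth_N open_U)

lemma smooth_shape_inverse: "smooth_matrix_on U shape_inverse"
proof -
  have "smooth_matrix_on U (\<lambda>u. (\<chi> a b. - (ddir N u (axis a 1) \<bullet> ddir X u (axis b 1))))"
    unfolding smooth_matrix_on_def vec_lambda_beta
    by (intro allI smooth_on_minus smooth_on_inner smooth_on_ddir_const smooth_N smooth_X open_U)
  then show ?thesis
    unfolding shape_inverse_def[abs_def]
    by (intro smooth_matrix_on_mult smooth_matrix_on_inverse smooth_T T_det open_U)
qed

lemma shape_inverse_frame:
  assumes u: "u \<in> U" and e: "principal_frame X N k u e"
  shows "shape_inverse u *v e i = radius k i u *\<^sub>R e i"
proof -
  have "((\<chi> a b. - (ddir N u (axis a 1) \<bullet> ddir X u (axis b 1))) *v e i) $ a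
      = (T u *v (radius k i u *\<^sub>R e i)) $ a" for a
  proof -
    have "((\<chi> a b. - (ddir N u (axis a 1) \<bullet> ddir X u (axis b 1))) *v e i) $ a
        = - (ddir N u (axis a 1) \<bullet> ddir X u (e i))"
      unfolding ddir_expand[OF open_U smooth_X u, of "e i"]
      by (simp add: matrix_vector_mult_def inner_sum_right sum_negf mult_ac)
    also have "\<dots> = ddir N u (axis a 1) \<bullet> ddir N u (radius k i u *\<^sub>R e i)"
      by (simp add: ddir_X_e[OF u e] linear_cmul[OF linear_N[OF u]])
    also have "\<dots> = (T u *v (radius k i u *\<^sub>R e i)) $ a"
      unfolding T_mult[OF u, symmetric] by (simp add: inner_axis')
    finally show ?thesis .
  qed
  then have "(\<chi> a b. - (ddir N u (axis a 1) \<bullet> ddir X u (axis b 1))) *v e i = T u *v (radius k i u *\<^sub>R e i)"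
    by (simp add: vec_eq_iff)
  then have "shape_inverse u *v e i = matrix_inv (T u) *v (T u *v (radius k i u *\<^sub>R e i))"
    unfolding shape_inverse_def matrix_vector_mul_assoc[symmetric] by (rule arg_cong)
  then show ?thesis by (simp add: matrix_vector_mul_assoc T_inv[OF u])
qed

text \<open>The trace involves no choice of frame, which is what makes the mean radius
  smooth.\<close>

lemma mean_radius_trace: "u \<in> U \<Longrightarrow> R u = trace (shape_inverse u) / real CARD('n)"
proof -
  assume u: "u \<in> U"
  obtain e where e: "principal_frame X N k u e" using frame[OF u] by (elim exE)
  show ?thesis
    using trace_eigenbasis[OF linear_coordinate[OF u e] coordinate_dual[OF u e] shape_inverse_frame[OF u e]]
    by (simp add: mean_radius_def)
qed

lemma smooth_mean_radius: "smooth_on U R"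
proof -
  have "smooth_on U (\<lambda>u. trace (shape_inverse u) / real CARD('n))"
    by (intro smooth_on_divide smooth_on_trace smooth_shape_inverse smooth_on_const open_U) simp
  then show ?thesis using smooth_on_cong[OF open_U mean_radius_trace] by simp
qed

text \<open>Up to the factor \<open>rho\<close>, the Laguerre second fundamental form as an
  endomorphism.\<close>

definition traceless :: "real ^ 'n \<Rightarrow> real ^ 'n ^ 'n" where
  "traceless u = R u *\<^sub>R mat 1 - shape_inverse u"

lemma smooth_traceless: "smooth_matrix_on U traceless"
  unfolding traceless_def[abs_def]
  by (intro smooth_matrix_on_diff smooth_matrix_on_scaleR smooth_matrix_on_const smooth_mean_radius
      smooth_shape_inverse open_U)

lemma traceless_frame:
  assumes "u \<in> U" "principal_frame X N k u e"
  shows "traceless u *v e i = (R u - radius k i u) *\<^sub>R e i"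
  by (simp add: traceless_def matrix_vector_mult_diff_rdistrib scaleR_matrix_vector_assoc[symmetric]
      shape_inverse_frame[OF assms] algebra_simps)

lemma rho_trace: "u \<in> U \<Longrightarrow> rho k u = sqrt (trace (traceless u ** traceless u))"
proof -
  assume u: "u \<in> U"
  obtain e where e: "principal_frame X N k u e" using frame[OF u] by (elim exE)
  have "(traceless u ** traceless u) *v e i = (R u - radius k i u)\<^sup>2 *\<^sub>R e i" for i
    by (simp add: matrix_vector_mul_assoc[symmetric] traceless_frame[OF u e] power2_eq_square
        linear_cmul[OF matrix_vector_mul_linear])
  then show ?thesis
    using trace_eigenbasis[OF linear_coordinate[OF u e] coordinate_dual[OF u e],
        of "traceless u ** traceless u" "\<lambda>i. (R u - radius k i u)\<^sup>2"]
    by (simp add: rho_def)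
qed

lemma rho_pos: "u \<in> U \<Longrightarrow> rho k u > 0"
proof -
  assume u: "u \<in> U"
  obtain i j where ij: "k u i \<noteq> k u j" using not_umbilic[OF u] by (auto simp: umbilic_def)
  then have "radius k i u \<noteq> radius k j u" using k_nz[OF u] by (simp add: radius_def)
  then obtain i where "R u - radius k i u \<noteq> 0" by (metis eq_iff_diff_eq_0)
  then have "(\<Sum>i\<in>UNIV. (R u - radius k i u)\<^sup>2) > 0"
    by (intro sum_pos2[of _ i]) auto
  then show ?thesis by (simp add: rho_def)
qed

lemma smooth_rho: "smooth_on U (rho k)"
proof -
  have "smooth_on U (\<lambda>u. sqrt (trace (traceless u ** traceless u)))"
    using rho_pos rho_trace
    by (intro smooth_on_sqrt smooth_on_trace smooth_matrix_on_mult smooth_traceless open_U) auto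
  then show ?thesis using smooth_on_cong[OF open_U rho_trace] by simp
qed

section \<open>Gradient and Hessian for the third fundamental form\<close>

definition grad :: "(real ^ 'n \<Rightarrow> real) \<Rightarrow> real ^ 'n \<Rightarrow> real ^ 'm" where
  "grad f u = ddir N u (grad_III N f u)"

lemma T_inv_sym:
  assumes "u \<in> U"
  shows "matrix_inv (T u) $ a $ b = matrix_inv (T u) $ b $ a"
proof -
  have "transpose (T u) = T u"
    by (simp add: vec_eq_iff transpose_def third_mat_def third_form_def inner_commute)
  then have "transpose (matrix_inv (T u)) ** T u = mat 1"
    using matrix_transpose_mul[of "T u" "matrix_inv (T u)"] T_inv(1)[OF assms] by (simp add: transpose_mat)
  then have "transpose (matrix_inv (T u)) = matrix_inv (T u)"
    using T_inv(1)[OF assms] by (metis matrix_mul_assoc matrix_mul_lid matrix_mul_rid)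
  then show ?thesis by (metis (mono_tags) transpose_def vec_lambda_beta)
qed

text \<open>\<open>dN\<close> is isometric from \<open>III\<close> to the Euclidean product, so
  \<open>grad f u\<close> is the intrinsic gradient realised as an ambient vector.\<close>

lemma grad_inner:
  assumes "smooth_on U f" "u \<in> U"
  shows "grad f u \<bullet> ddir N u v = ddir f u v"
proof -
  have "grad f u \<bullet> ddir N u v = v \<bullet> (T u *v grad_III N f u)"
    by (simp add: grad_def T_mult[OF assms(2)] inner_commute)
  also have "\<dots> = v \<bullet> (\<chi> a. pd a f u)"
    by (simp add: grad_III_def matrix_vector_mul_assoc T_inv[OF assms(2)])
  also have "\<dots> = ddir f u v"
    unfolding ddir_expand[OF open_U assms, of v] by (simp add: inner_vec_def pd_def)
  finally show ?thesis .
qed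

lemma grad_N: "u \<in> U \<Longrightarrow> grad f u \<bullet> N u = 0"
  using N_ddir[of u "grad_III N f u"] by (simp add: grad_def inner_commute)

text \<open>\<open>III\<close> is induced by \<open>N\<close>. After differentiating its
  coefficients, symmetry of the second derivatives of \<open>N\<close> cancels all but two equal
  terms.\<close>

lemma christoffel_eq:
  assumes u: "u \<in> U"
  shows "christoffel_III N u c a b = (\<Sum>d\<in>UNIV. matrix_inv (T u) $ c $ d *
    (ddir (\<lambda>p. ddir N p (axis b 1)) u (axis a 1) \<bullet> ddir N u (axis d 1)))"
proof -
  let ?n = "\<lambda>a b. ddir (\<lambda>p. ddir N p (axis b 1)) u (axis a 1)" and ?N = "\<lambda>a. ddir N u (axis a 1)"
  have pd: "pd a (\<lambda>w. third_mat N w $ b $ d) u = ?N b \<bullet> ?n a d + ?n a b \<bullet> ?N d" for a b d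
    unfolding pd_def third_mat_def third_form_def vec_lambda_beta
    using smooth_on_ddir_const[OF smooth_N]
    by (intro bounded_bilinear.ddir[OF bounded_bilinear_inner open_U _ _ u])
  have sym: "?n a b = ?n b a" for a b
    by (rule ddir_ddir_sym[OF open_U smooth_N u])
  have "pd a (\<lambda>w. third_mat N w $ b $ d) u + pd b (\<lambda>w. third_mat N w $ a $ d) u
         - pd d (\<lambda>w. third_mat N w $ a $ b) u = 2 * (?n a b \<bullet> ?N d)" for d
    unfolding pd using sym[of a b] sym[of a d] sym[of b d] by (simp add: inner_commute)
  then show ?thesis
    unfolding christoffel_III_def by (simp add: sum_divide_distrib)
qed

text \<open>Contracting the Christoffel symbols with \<open>df\<close> pairs the gradient with
  second derivatives of \<open>N\<close>; no Christoffel symbols remain for the Lorentz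
  computation.\<close>

lemma Hess_III_eq:
  assumes "smooth_on U f" "u \<in> U"
  shows "Hess_III N f u v w = ddir (\<lambda>p. ddir f p w) u v - grad f u \<bullet> ddir (\<lambda>p. ddir N p w) u v"
proof -
  let ?n = "\<lambda>a b. ddir (\<lambda>p. ddir N p (axis b 1)) u (axis a 1)"
  have chr: "(\<Sum>c\<in>UNIV. christoffel_III N u c a b * pd c f u) = grad f u \<bullet> ?n a b" for a b
  proof -
    have "(\<Sum>c\<in>UNIV. christoffel_III N u c a b * pd c f u)
        = (\<Sum>c\<in>UNIV. \<Sum>d\<in>UNIV. matrix_inv (T u) $ d $ c * pd c f u * (ddir N u (axis d 1) \<bullet> ?n a b))"
      unfolding christoffel_eq[OF assms(2)] sum_distrib_right
      by (intro sum.cong refl) (simp add: T_inv_sym[OF assms(2)] inner_commute mult_ac)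
    also have "\<dots> = (\<Sum>d\<in>UNIV. (\<Sum>c\<in>UNIV. matrix_inv (T u) $ d $ c * pd c f u) * (ddir N u (axis d 1) \<bullet> ?n a b))"
      by (subst sum.swap) (simp add: sum_distrib_right)
    also have "\<dots> = grad f u \<bullet> ?n a b"
      unfolding grad_def ddir_expand[OF open_U smooth_N assms(2), of "grad_III N f u"] inner_sum_left
        inner_scaleR_left
      by (simp add: grad_III_def matrix_vector_mult_def)
    finally show ?thesis .
  qed
  show ?thesis
    unfolding Hess_III_def chr second_ddir_expand[OF open_U smooth_N assms(2), of w v]
      second_ddir_expand[OF open_U assms, of w v]
    by (simp add: pd_def[abs_def] inner_sum_right sum_subtractf[symmetric] algebra_simps)
qed

end

section \<open>Laguerre invariants in a chart\<close>

locale laguerre_chart = hypersurface_chart U X N k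
  for U :: "(real ^ 'n::finite) set" and X N :: "real ^ 'n \<Rightarrow> real ^ 'm::finite"
    and k :: "real ^ 'n \<Rightarrow> 'n \<Rightarrow> real" +
  fixes b :: "'n \<Rightarrow> real" and lam :: real
  assumes dim: "CARD('m) = CARD('n) + 1" and inj_b: "inj b"
    and curvature: "\<And>u i. u \<in> U \<Longrightarrow> laguerre_curvature k i u = b i"
    and form: "\<And>u e v. u \<in> U \<Longrightarrow> principal_frame X N k u e \<Longrightarrow> laguerre_form N k u e v = 0"
    and tensor: "\<And>u e i j. u \<in> U \<Longrightarrow> principal_frame X N k u e \<Longrightarrow>
      laguerre_L N k u e $ i $ j = lam * (if i = j then 1 else 0)"
begin

abbreviation f :: "real ^ 'n \<Rightarrow> real" where "f \<equiv> \<lambda>w. ln (rho k w)"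

lemma smooth_f: "smooth_on U f"
  by (intro smooth_on_ln smooth_rho rho_pos open_U)

lemma ddir_rho: "u \<in> U \<Longrightarrow> ddir (rho k) u v = rho k u * ddir f u v"
proof -
  assume u: "u \<in> U"
  have "(f has_derivative (\<lambda>v. ddir (rho k) u v * inverse (rho k u))) (at u)"
    using rho_pos[OF u]
    by (intro DERIV_compose_FDERIV[of ln] DERIV_ln smooth_on_has_derivative[OF open_U smooth_rho u])
  then show ?thesis using ddir_eqI rho_pos[OF u] by (fastforce simp: field_simps)
qed

lemma radius_eq: "u \<in> U \<Longrightarrow> R u - radius k i u = rho k u * b i"
  using curvature[of u i] rho_pos[of u] by (simp add: laguerre_curvature_def field_simps)

lemma radius_nz: "u \<in> U \<Longrightarrow> radius k i u \<noteq> 0"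
  using k_nz by (simp add: radius_def)

text \<open>The eigenvalues \<open>b i\<close> of the smooth field \<open>A\<close> are constant and
  distinct, so its spectral projections are, up to constants, polynomials in \<open>A\<close> and
  hence smooth. Projecting the frame at \<open>u0\<close> and normalising gives smooth eigenvector
  fields near \<open>u0\<close>.\<close>

lemma adapted_frame_exists:
  assumes u0: "u0 \<in> U"
  obtains V E where "open V" "u0 \<in> V" "V \<subseteq> U" "\<And>i. smooth_on V (E i)"
    "\<And>u. u \<in> V \<Longrightarrow> \<exists>e. principal_frame X N k u e \<and> (\<forall>i. E i u = laguerre_frame k u e i)"
proof -
  obtain e0 where e0: "principal_frame X N k u0 e0" using frame[OF u0] by (elim exE)
  define A where "A u = inverse (rho k u) *\<^sub>R traceless u" for u
  have sA: "smooth_matrix_on U A"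
    unfolding A_def[abs_def] using rho_pos
    by (intro smooth_matrix_on_scaleR smooth_on_inverse smooth_rho smooth_traceless open_U)
      (simp add: less_imp_neq[THEN not_sym])
  have A_frame: "A u *v e i = b i *\<^sub>R e i" if "u \<in> U" "principal_frame X N k u e" for u e i
    using rho_pos[OF that(1)]
    by (simp add: A_def scaleR_matrix_vector_assoc[symmetric] traceless_frame[OF that] radius_eq[OF that(1)])
  have "\<exists>Q. smooth_matrix_on U Q \<and>
    (\<forall>u v c. A u *v v = c *\<^sub>R v \<longrightarrow> Q u *v v = (\<Prod>j\<in>UNIV - {i}. c - b j) *\<^sub>R v)" for i
    by (rule smooth_annihilator[OF open_U sA]) simp
  then obtain Q where sQ: "\<And>i. smooth_matrix_on U (Q i)"
    and Q: "\<And>i u v c. A u *v v = c *\<^sub>R v \<Longrightarrow> Q i u *v v = (\<Prod>j\<in>UNIV - {i}. c - b j) *\<^sub>R v"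
    by metis
  \<comment> \<open>The coordinate vector \<open>e0 i\<close> stays fixed while the projection
    varies with \<open>u\<close>.\<close>
  define w where "w i u = Q i u *v e0 i" for i u
  have sw: "smooth_on U (w i)" for i
    unfolding w_def[abs_def] by (rule smooth_on_matrix_vector_mult[OF open_U sQ])
  have w_e: "\<exists>s. w i u = s *\<^sub>R e i" if u: "u \<in> U" and e: "principal_frame X N k u e" for u e i
  proof -
    let ?c = "\<lambda>m. ddir X u (e0 i) \<bullet> ddir X u (e m)" and ?p = "\<lambda>m. \<Prod>j\<in>UNIV - {i}. b m - b j"
    have "w i u = Q i u *v (\<Sum>m\<in>UNIV. ?c m *\<^sub>R e m)"
      unfolding w_def by (rule arg_cong[OF frame_expand[OF u e]])
    also have "\<dots> = (\<Sum>m\<in>UNIV. ?c m *\<^sub>R ?p m *\<^sub>R e m)"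
      by (simp add: linear_sum[OF matrix_vector_mul_linear] linear_cmul[OF matrix_vector_mul_linear]
          Q[OF A_frame[OF u e]])
    \<comment> \<open>For \<open>m\<close> other than \<open>i\<close> the product
      \<open>?p m\<close> contains the zero factor \<open>b m - b m\<close>.\<close>
    also have "\<dots> = (\<Sum>m\<in>{i}. ?c m *\<^sub>R ?p m *\<^sub>R e m)"
      by (rule sum.mono_neutral_right) auto
    finally show ?thesis by (intro exI[of _ "?c i * ?p i"]) simp
  qed
  have w0: "w i u0 \<noteq> 0" for i
  proof -
    have "(\<Prod>j\<in>UNIV - {i}. b i - b j) \<noteq> 0" using inj_b by (auto dest: injD)
    then show ?thesis
      using Q[OF A_frame[OF u0 e0], of i i] e_nz[OF u0 e0, of i] by (simp add: w_def)
  qed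
  define V where "V = U \<inter> (\<Inter>i. U \<inter> w i -` (- {0}))"
  have "open (U \<inter> w i -` (- {0}))" for i
    using smooth_on_continuous[OF sw] open_U by (rule continuous_open_preimage) auto
  then have V: "open V" unfolding V_def using open_U by (intro open_Int open_INT) auto
  have V_U: "V \<subseteq> U" and V_w: "\<And>u i. u \<in> V \<Longrightarrow> w i u \<noteq> 0" by (auto simp: V_def)
  define n where "n i u = sqrt (ddir N u (w i u) \<bullet> ddir N u (w i u))" for i u
  have n_pos: "ddir N u (w i u) \<bullet> ddir N u (w i u) > 0" if "u \<in> V" for u i
    using ddir_N_eq_0[of u "w i u"] V_w[OF that] V_U that by auto
  note sub = smooth_on_subset[OF V V_U]
  define E where "E i u = inverse (rho k u * n i u) *\<^sub>R w i u" for i u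
  have sE: "smooth_on V (E i)" for i
    unfolding E_def[abs_def] n_def
  proof (intro smooth_on_scaleR smooth_on_inverse smooth_on_mult smooth_on_sqrt V)
    show "smooth_on V (rho k)" "smooth_on V (w i)" by (intro sub smooth_rho sw)+
    show "smooth_on V (\<lambda>u. ddir N u (w i u) \<bullet> ddir N u (w i u))"
      by (intro smooth_on_inner smooth_on_ddir V sub smooth_N sw)
    show "rho k u * sqrt (ddir N u (w i u) \<bullet> ddir N u (w i u)) \<noteq> 0" if "u \<in> V" for u
      using n_pos[OF that, of i] rho_pos[of u] that V_U by auto
  qed (rule n_pos)
  have ex: "\<exists>e. principal_frame X N k u e \<and> (\<forall>i. E i u = laguerre_frame k u e i)" if "u \<in> V" for u
  proof -
    have u: "u \<in> U" using that V_U by blast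
    obtain e where e: "principal_frame X N k u e" using frame[OF u] by (elim exE)
    obtain s where s: "\<And>i. w i u = s i *\<^sub>R e i" using w_e[OF u e] by metis
    have s0: "s i \<noteq> 0" for i using V_w[OF that, of i] s[of i] by auto
    have "ddir N u (w i u) \<bullet> ddir N u (w i u) = (s i * k u i)\<^sup>2" for i
      by (simp add: s linear_cmul[OF linear_N[OF u]] ddir_N_frame[OF u e] power2_eq_square mult_ac)
    then have n: "n i u = \<bar>s i * k u i\<bar>" for i
      by (simp add: n_def)
    \<comment> \<open>Normalisation fixes a principal vector up to sign. The sign of
      \<open>k u i\<close> enters as well, since \<open>laguerre_frame\<close> carries the signed
      radius while \<open>n i u\<close> is positive.\<close>
    define t where "t i = sgn (s i * k u i)" for i
    have t: "t i * t i = 1" for i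
      using s0[of i] k_nz[OF u, of i] by (simp add: t_def sgn_if)
    have "principal_frame X N k u (\<lambda>i. t i *\<^sub>R e i)"
      using e t unfolding principal_frame_def
      by (simp add: linear_cmul[OF linear_N[OF u]] linear_cmul[OF linear_X[OF u]])
    moreover have "E i u = laguerre_frame k u (\<lambda>i. t i *\<^sub>R e i) i" for i
    proof -
      have "inverse \<bar>s i * k u i\<bar> * s i = t i / k u i"
        using s0[of i] k_nz[OF u, of i] by (auto simp: t_def sgn_if abs_if field_simps)
      then have "inverse (rho k u * n i u) * s i = t i / k u i / rho k u"
        by (simp add: n divide_inverse mult_ac)
      then show ?thesis by (simp add: E_def laguerre_frame_def s radius_def mult_ac)
    qed
    ultimately show ?thesis by blast
  qed
  have "u0 \<in> V" using w0 u0 by (simp add: V_def)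
  then show thesis by (rule that[OF V _ V_U sE ex])
qed

section \<open>The Lorentzian lifts and the Laguerre invariants read off from them\<close>

definition Y :: "real ^ 'n \<Rightarrow> (real ^ 'm) \<times> real" where
  "Y u = rho k u *\<^sub>R (N u, 1)"

definition \<eta> :: "real ^ 'n \<Rightarrow> (real ^ 'm) \<times> real" where
  "\<eta> u = (X u + R u *\<^sub>R N u, R u)"

text \<open>The null vector orthogonal to the image of \<open>dY\<close> and of product 1 with
  \<open>Y\<close>; these conditions force the gradient term.\<close>

definition Z :: "real ^ 'n \<Rightarrow> (real ^ 'm) \<times> real" where
  "Z u = inverse (rho k u) *\<^sub>R
    (((1 - grad f u \<bullet> grad f u) / 2) *\<^sub>R N u - grad f u, - (1 + grad f u \<bullet> grad f u) / 2)"

lemma smooth_Y: "smooth_on U Y"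
  unfolding Y_def[abs_def] by (intro smooth_on_scaleR smooth_on_Pair smooth_on_const smooth_rho smooth_N open_U)

lemma smooth_eta: "smooth_on U \<eta>"
  unfolding \<eta>_def[abs_def]
  by (intro smooth_on_scaleR smooth_on_Pair smooth_on_add smooth_mean_radius smooth_N smooth_X open_U)

lemma ddir_Y:
  assumes u: "u \<in> U"
  shows "ddir Y u v = rho k u *\<^sub>R (ddir N u v + ddir f u v *\<^sub>R N u, ddir f u v)"
proof -
  have "ddir Y u v = rho k u *\<^sub>R ddir (\<lambda>u. (N u, 1::real)) u v + ddir (rho k) u v *\<^sub>R (N u, 1)"
    unfolding Y_def[abs_def]
    by (intro bounded_bilinear.ddir[OF bounded_bilinear_scaleR open_U smooth_rho _ u] smooth_on_Pair
        smooth_N smooth_on_const open_U)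
  also have "ddir (\<lambda>u. (N u, 1::real)) u v = (ddir N u v, 0)"
    by (simp add: ddir_Pair[OF open_U smooth_N smooth_on_const u])
  finally show ?thesis by (simp add: ddir_rho[OF u] scaleR_add_right)
qed

lemma ddir_ddir_Y:
  assumes u: "u \<in> U"
  shows "ddir (\<lambda>p. ddir Y p v) u w =
    (rho k u * ddir f u w) *\<^sub>R (ddir N u v + ddir f u v *\<^sub>R N u, ddir f u v) +
    rho k u *\<^sub>R (ddir (\<lambda>p. ddir N p v) u w + ddir f u v *\<^sub>R ddir N u w
      + ddir (\<lambda>p. ddir f p v) u w *\<^sub>R N u, ddir (\<lambda>p. ddir f p v) u w)"
proof -
  note sN = smooth_on_ddir_const[OF smooth_N, of v] and sf = smooth_on_ddir_const[OF smooth_f, of v]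
  have sfN: "smooth_on U (\<lambda>p. ddir f p v *\<^sub>R N p)"
    by (intro smooth_on_scaleR open_U smooth_N sf)
  have s1: "smooth_on U (\<lambda>p. ddir N p v + ddir f p v *\<^sub>R N p)"
    by (intro smooth_on_add open_U sfN sN)
  have "ddir (\<lambda>p. ddir Y p v) u w
      = ddir (\<lambda>p. rho k p *\<^sub>R (ddir N p v + ddir f p v *\<^sub>R N p, ddir f p v)) u w"
    by (rule ddir_cong[OF open_U smooth_on_ddir_const[OF smooth_Y] u ddir_Y])
  also have "\<dots> = rho k u *\<^sub>R ddir (\<lambda>p. (ddir N p v + ddir f p v *\<^sub>R N p, ddir f p v)) u w
      + ddir (rho k) u w *\<^sub>R (ddir N u v + ddir f u v *\<^sub>R N u, ddir f u v)"
    by (intro bounded_bilinear.ddir[OF bounded_bilinear_scaleR open_U smooth_rho _ u] smooth_on_Pair s1 sf open_U)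
  also have "ddir (\<lambda>p. (ddir N p v + ddir f p v *\<^sub>R N p, ddir f p v)) u w
      = (ddir (\<lambda>p. ddir N p v + ddir f p v *\<^sub>R N p) u w, ddir (\<lambda>p. ddir f p v) u w)"
    by (rule ddir_Pair[OF open_U s1 sf u])
  also have "ddir (\<lambda>p. ddir N p v + ddir f p v *\<^sub>R N p) u w
      = ddir (\<lambda>p. ddir N p v) u w + ddir (\<lambda>p. ddir f p v *\<^sub>R N p) u w"
    by (rule ddir_add[OF open_U sN sfN u])
  also have "ddir (\<lambda>p. ddir f p v *\<^sub>R N p) u w
      = ddir f u v *\<^sub>R ddir N u w + ddir (\<lambda>p. ddir f p v) u w *\<^sub>R N u"
    by (rule bounded_bilinear.ddir[OF bounded_bilinear_scaleR open_U sf smooth_N u])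
  finally show ?thesis by (simp add: ddir_rho[OF u] add_ac)
qed

lemma ddir_ddir_N:
  assumes u: "u \<in> U"
  shows "N u \<bullet> ddir (\<lambda>p. ddir N p v) u w = - (ddir N u v \<bullet> ddir N u w)"
proof -
  have "ddir (\<lambda>p. N p \<bullet> ddir N p v) u w = ddir (\<lambda>p. 0) u w"
    by (intro ddir_cong[OF open_U _ u] smooth_on_inner smooth_on_ddir_const smooth_N open_U N_ddir)
  then show ?thesis
    using bounded_bilinear.ddir[OF bounded_bilinear_inner open_U smooth_N smooth_on_ddir_const[OF smooth_N] u]
    by (simp add: inner_commute add_eq_0_iff)
qed

lemma inner_facts:
  assumes u: "u \<in> U"
  shows "N u \<bullet> N u = 1" "N u \<bullet> ddir N u v = 0" "ddir N u v \<bullet> N u = 0"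
    "grad f u \<bullet> N u = 0" "N u \<bullet> grad f u = 0"
    "grad f u \<bullet> ddir N u v = ddir f u v" "ddir N u v \<bullet> grad f u = ddir f u v"
    "N u \<bullet> ddir (\<lambda>p. ddir N p v) u w = - third_form N u v w"
    "ddir (\<lambda>p. ddir N p v) u w \<bullet> N u = - third_form N u v w"
  using unit[OF u] N_ddir[OF u, of v] grad_N[OF u, of f] grad_inner[OF smooth_f u, of v] ddir_ddir_N[OF u, of v w]
  by (simp_all add: inner_commute third_form_def)

text \<open>These relations make \<open>Y\<close>, \<open>Z\<close> and the images of the Laguerre
  frame a basis for \<open>lorentz_parseval\<close>; the last one identifies the metric induced by
  \<open>Y\<close> with the Laguerre metric.\<close>

lemma lorentz_Y:
  assumes u: "u \<in> U"
  shows "lorentz (Y u) (Y u) = 0" "lorentz (Z u) (Z u) = 0" "lorentz (Y u) (Z u) = 1"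
    "lorentz (ddir Y u v) (Y u) = 0" "lorentz (ddir Y u v) (Z u) = 0"
    "lorentz (ddir Y u v) (ddir Y u w) = (rho k u)\<^sup>2 * third_form N u v w"
  using rho_pos[OF u]
  unfolding ddir_Y[OF u] unfolding Y_def Z_def lorentz.scaleR_left lorentz.scaleR_right
  unfolding lorentz_def fst_conv snd_conv inner_add_left inner_add_right inner_diff_left inner_diff_right
    inner_scaleR_left inner_scaleR_right inner_facts[OF u] third_form_def
  by (simp_all add: field_simps power2_eq_square)

text \<open>The right-hand side is the Laguerre tensor as a bilinear form: on the vectors
  \<open>r_i e_i = rho E_i\<close> it gives the bracket in \<open>laguerre_L\<close>, and the factor
  \<open>1 / rho^2\<close> there amounts to passing to \<open>E_i\<close>.\<close>

lemma lorentz_second_Z: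
  assumes u: "u \<in> U"
  shows "lorentz (ddir (\<lambda>p. ddir Y p v) u w) (Z u) = Hess_III N f u w v - ddir f u v * ddir f u w
    + (grad f u \<bullet> grad f u - 1) / 2 * third_form N u v w"
  using rho_pos[OF u]
  unfolding ddir_ddir_Y[OF u] Hess_III_eq[OF smooth_f u]
  unfolding Z_def lorentz.scaleR_left lorentz.scaleR_right lorentz.add_left
  unfolding lorentz_def fst_conv snd_conv inner_add_left inner_add_right inner_diff_left inner_diff_right
    inner_scaleR_left inner_scaleR_right inner_facts[OF u] 
    inner_commute[of "ddir (\<lambda>p. ddir N p v) u w" "grad f u"]
  by (simp add: field_simps)

lemma third_form_laguerre_frame:
  assumes u: "u \<in> U" and e: "principal_frame X N k u e"
  shows "(rho k u)\<^sup>2 * third_form N u (laguerre_frame k u e i) (laguerre_frame k u e j) = (if i = j then 1 else 0)"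
  using rho_pos[OF u] k_nz[OF u, of i] k_nz[OF u, of j]
  by (simp add: third_form_def laguerre_frame_def linear_cmul[OF linear_N[OF u]] ddir_N_frame[OF u e]
      radius_def power2_eq_square)

text \<open>Evaluating the Laguerre form on \<open>E_i\<close> isolates \<open>C_i\<close>, whose
  prefactor is nonzero.\<close>

lemma laguerre_C_eq_0:
  assumes u: "u \<in> U" and e: "principal_frame X N k u e"
  shows "ddir R u (e i) = (R u - radius k i u) * ddir f u (e i)"
proof -
  have "laguerre_coframe N k u e j (laguerre_frame k u e i) = (if i = j then 1 else 0)" for j
    using third_form_laguerre_frame[OF u e, of i j] by (simp add: laguerre_coframe_def laguerre_metric_def)
  then have "(\<Sum>j\<in>UNIV. laguerre_C k u e j * (if i = j then 1 else 0)) = 0"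
    using form[OF u e, of "laguerre_frame k u e i"] unfolding laguerre_form_def by (simp only:)
  then have "laguerre_C k u e i = 0"
    by (simp add: if_distrib cong: if_cong)
  then show ?thesis
    using rho_pos[OF u] radius_nz[OF u, of i] by (simp add: laguerre_C_def)
qed

text \<open>Replacing \<open>dX(e_i)\<close> by \<open>- r_i dN(e_i)\<close> and
  \<open>dr(e_i)\<close> by \<open>(r - r_i) df(e_i)\<close> exposes the common factor
  \<open>r - r_i = rho b_i\<close>, and the remaining vector is
  \<open>dY(e_i) / rho\<close>.\<close>

lemma ddir_eta:
  assumes u: "u \<in> U" and e: "principal_frame X N k u e"
  shows "ddir \<eta> u (laguerre_frame k u e i) = b i *\<^sub>R ddir Y u (laguerre_frame k u e i)"
proof -
  have sRN: "smooth_on U (\<lambda>u. R u *\<^sub>R N u)"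
    by (intro smooth_on_scaleR smooth_mean_radius smooth_N open_U)
  have d: "ddir \<eta> u v = (ddir X u v + (R u *\<^sub>R ddir N u v + ddir R u v *\<^sub>R N u), ddir R u v)" for v
    unfolding \<eta>_def[abs_def]
    using ddir_Pair[OF open_U smooth_on_add[OF open_U smooth_X sRN] smooth_mean_radius u]
      ddir_add[OF open_U smooth_X sRN u]
      bounded_bilinear.ddir[OF bounded_bilinear_scaleR open_U smooth_mean_radius smooth_N u]
    by simp
  have "ddir \<eta> u (e i) = (R u - radius k i u) *\<^sub>R (ddir N u (e i) + ddir f u (e i) *\<^sub>R N u, ddir f u (e i))"
    unfolding d ddir_X_e[OF u e] laguerre_C_eq_0[OF u e] by (simp add: algebra_simps)
  then have "ddir \<eta> u (e i) = b i *\<^sub>R ddir Y u (e i)"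
    by (simp add: ddir_Y[OF u] radius_eq[OF u] mult.commute)
  then show ?thesis
    unfolding laguerre_frame_def
    by (simp only: linear_cmul[OF smooth_on_linear[OF open_U smooth_eta u]]
        linear_cmul[OF smooth_on_linear[OF open_U smooth_Y u]] scaleR_left_commute)
qed

lemma second_fundamental_form:
  assumes u: "u \<in> U" and e: "principal_frame X N k u e"
  shows "lorentz (ddir (\<lambda>p. ddir Y p (laguerre_frame k u e j)) u (laguerre_frame k u e i)) (Z u)
    = (if i = j then lam else 0)"
proof -
  let ?E = "laguerre_frame k u e" and ?\<rho> = "rho k u"
  have r: "radius k i u *\<^sub>R e i = ?\<rho> *\<^sub>R ?E i" for i
    using rho_pos[OF u] by (simp add: laguerre_frame_def)
  have df: "radius k i u * ddir f u (e i) = ?\<rho> * ddir f u (?E i)" for i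
    using rho_pos[OF u] by (simp add: laguerre_frame_def linear_cmul[OF smooth_on_linear[OF open_U smooth_f u]])
  have H: "Hess_III N f u (c *\<^sub>R v) (c *\<^sub>R w) = c\<^sup>2 * Hess_III N f u v w" for c v w
    by (simp add: Hess_III_def sum_distrib_left power2_eq_square algebra_simps)
  have "laguerre_L N k u e $ i $ j =
      (?\<rho>\<^sup>2 * Hess_III N f u (?E i) (?E j) - (radius k i u * ddir f u (e i)) * (radius k j u * ddir f u (e j))
        + (grad f u \<bullet> grad f u - 1) / 2 * (if j = i then 1 else 0)) / ?\<rho>\<^sup>2"
    by (simp add: laguerre_L_def Let_def r H grad_def third_form_def mult_ac)
  also have "\<dots> =
      (?\<rho>\<^sup>2 * Hess_III N f u (?E i) (?E j) - ?\<rho>\<^sup>2 * (ddir f u (?E i) * ddir f u (?E j))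
        + (grad f u \<bullet> grad f u - 1) / 2 * (?\<rho>\<^sup>2 * third_form N u (?E j) (?E i))) / ?\<rho>\<^sup>2"
    unfolding df third_form_laguerre_frame[OF u e, of j i] by (simp add: power2_eq_square mult_ac)
  also have "\<dots> = lorentz (ddir (\<lambda>p. ddir Y p (?E j)) u (?E i)) (Z u)"
    using rho_pos[OF u] by (simp add: lorentz_second_Z[OF u] field_simps)
  finally show ?thesis using tensor[OF u e, of i j] by (simp split: if_splits)
qed

lemma lam_eq_0:
  assumes "u \<in> U" "CARD('n) \<ge> 2"
  shows "lam = 0"
proof -
  obtain V E where V: "open V" "u \<in> V" "V \<subseteq> U" and sE: "\<And>i. smooth_on V (E i)"
    and ex: "\<And>u. u \<in> V \<Longrightarrow> \<exists>e. principal_frame X N k u e \<and> (\<forall>i. E i u = laguerre_frame k u e i)"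
    using adapted_frame_exists[OF assms(1)] by metis
  interpret lorentz_codazzi_frame V E Y \<eta> Z b lam
  proof
    show "open V" "smooth_on V (E i)" for i by (fact V(1) sE)+
    show sY: "smooth_on V Y" "smooth_on V \<eta>"
      by (rule smooth_on_subset[OF V(1,3)], fact smooth_Y smooth_eta)+
    fix u assume "u \<in> V"
    then have u: "u \<in> U" using V(3) by blast
    obtain e where e: "principal_frame X N k u e" and E: "\<And>i. E i u = laguerre_frame k u e i"
      using ex[OF \<open>u \<in> V\<close>] by blast
    show "lorentz (Y u) (Y u) = 0" by (rule lorentz_Y[OF u])
    show orth: "lorentz (ddir Y u (E i u)) (ddir Y u (E j u)) = (if i = j then 1 else 0)" for i j
      by (simp only: lorentz_Y[OF u] E third_form_laguerre_frame[OF u e])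
    show "ddir \<eta> u (E i u) = b i *\<^sub>R ddir Y u (E i u)" for i
      by (simp only: E ddir_eta[OF u e])
    show "lorentz p q = (\<Sum>m\<in>UNIV. lorentz p (ddir Y u (E m u)) * lorentz q (ddir Y u (E m u)))
        + lorentz p (Y u) * lorentz q (Z u) + lorentz p (Z u) * lorentz q (Y u)" for p q
      by (rule lorentz_parseval[OF _ orth]) (simp_all add: dim lorentz_Y(1-5)[OF u])
    \<comment> \<open>Differentiating the moving field instead of a frozen direction adds only a
      vector in the image of \<open>dY\<close>, which is orthogonal to \<open>Z\<close>.\<close>
    show "lorentz (ddir (\<lambda>w. ddir Y w (E l w)) u (E k u)) (Z u) = (if k = l then lam else 0)" for k l
      using second_fundamental_form[OF u e, of l k]
      by (simp add: ddir_ddir_field[OF V(1) sY(1) sE \<open>u \<in> V\<close>] lorentz.add_left lorentz_Y[OF u] E)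
  qed
  show ?thesis by (rule lam_eq_0[OF inj_b V(2) assms(2)])
qed

end

section \<open>Passage from charts to the manifold\<close>

theorem proposition1:
  fixes M :: "'p topology"
    and \<A> :: "('n::finite, 'p) param set"
    and x \<xi> :: "'p \<Rightarrow> real ^ 'm::finite"
    and k :: "'p \<Rightarrow> 'n \<Rightarrow> real"
    and lam :: real
  assumes "oriented_hypersurface M \<A> x \<xi>"
    and "topspace M \<noteq> {}"
    and "CARD('n) \<ge> 3"
    and "principal_curvatures \<A> x \<xi> k"
    and "\<And>p. p \<in> topspace M \<Longrightarrow> \<not> umbilic k p"
    and "\<And>p i. p \<in> topspace M \<Longrightarrow> k p i \<noteq> 0"
    and "\<And>p i j. p \<in> topspace M \<Longrightarrow> i \<noteq> j \<Longrightarrow> k p i \<noteq> k p j"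
    and "L_isotropic \<A> x \<xi> k lam"
    and "L_isoparametric M \<A> x \<xi> k"
  shows "lam = 0 \<and> (\<forall>p \<in> topspace M. \<forall>\<mu>. laguerre_eigenvalue \<A> x \<xi> k p \<mu> \<longrightarrow> \<mu> = 0)"
proof -
  note hyp = assms(1)[unfolded oriented_hypersurface_def]
  have charts: "open U" "\<And>u. u \<in> U \<Longrightarrow> \<phi> u \<in> topspace M" if "(U, \<phi>) \<in> \<A>" for U \<phi>
    using hyp that unfolding smooth_manifold_def by (blast, blast)
  have "(\<Union>(U, \<phi>) \<in> \<A>. \<phi> ` U) = topspace M"
    using hyp unfolding smooth_manifold_def by blast
  \<comment> \<open>A single chart with one point suffices, because \<open>lam\<close> is the same
    constant on the whole manifold.\<close>
  then obtain U \<phi> u0 where c: "(U, \<phi>) \<in> \<A>" and u0: "u0 \<in> U"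
    using assms(2) by fastforce
  obtain b where b: "\<And>i p. p \<in> topspace M \<Longrightarrow> laguerre_curvature k i p = b i"
    using assms(9) unfolding L_isoparametric_def by metis
  let ?X = "x \<circ> \<phi>" and ?N = "\<xi> \<circ> \<phi>" and ?k = "k \<circ> \<phi>"
  interpret hypersurface_chart U ?X ?N ?k
  proof
    show "open U" by (rule charts[OF c])
    show "smooth_on U ?X" "smooth_on U ?N" using hyp c by auto
    fix u assume u: "u \<in> U"
    have "norm (?N u) = 1" using hyp c u by auto
    then show "?N u \<bullet> ?N u = 1" by (simp add: norm_eq_1)
    show "\<exists>e. principal_frame ?X ?N ?k u e"
      using assms(4) c u unfolding principal_curvatures_def by blast
    show "?k u i \<noteq> 0" for i using assms(6)[OF charts(2)[OF c u]] by simp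
    show "\<not> umbilic ?k u" using assms(5)[OF charts(2)[OF c u]] by (simp add: umbilic_def)
  qed
  have curv: "laguerre_curvature ?k i u = b i" if "u \<in> U" for i u
    using b[OF charts(2)[OF c that], of i]
    by (simp add: laguerre_curvature_def mean_radius_def radius_def rho_def)
  interpret laguerre_chart U ?X ?N ?k b lam
  proof
    show "CARD('m) = CARD('n) + 1" using hyp by blast
    \<comment> \<open>The \<open>b i\<close> are constant, so comparing them at \<open>u0\<close> is
      enough: there equal values force equal radii, hence equal principal curvatures.\<close>
    show "inj b"
    proof (rule injI)
      fix i j assume "b i = b j"
      then have "radius ?k i u0 = radius ?k j u0"
        using curv[OF u0, of i] curv[OF u0, of j] rho_pos[OF u0]
        by (simp add: laguerre_curvature_def field_simps)
      then have "k (\<phi> u0) i = k (\<phi> u0) j" by (simp add: radius_def)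
      then show "i = j" using assms(7)[OF charts(2)[OF c u0]] by blast
    qed
    show "laguerre_form ?N ?k u e v = 0" if "u \<in> U" "principal_frame ?X ?N ?k u e" for u e v
      using assms(8) c that unfolding L_isotropic_def laguerre_form_vanishes_def by blast
    show "laguerre_L ?N ?k u e $ i $ j = lam * (if i = j then 1 else 0)"
      if "u \<in> U" "principal_frame ?X ?N ?k u e" for u e i j
      using assms(8) c that unfolding L_isotropic_def by blast
  qed (rule curv)
  have "lam = 0" using u0 assms(3) by (intro lam_eq_0) auto
  \<comment> \<open>The eigenvalue may be witnessed in any chart; L-isotropy with
    \<open>lam = 0\<close> makes the whole component matrix vanish there.\<close>
  moreover have "\<mu> = 0" if ev: "laguerre_eigenvalue \<A> x \<xi> k p \<mu>" for p \<mu>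
  proof -
    obtain U \<phi> u e w where "(U, \<phi>) \<in> \<A>" "u \<in> U"
      "principal_frame (x \<circ> \<phi>) (\<xi> \<circ> \<phi>) (k \<circ> \<phi>) u e" and w: "w \<noteq> 0"
      "laguerre_L (\<xi> \<circ> \<phi>) (k \<circ> \<phi>) u e *v w = \<mu> *\<^sub>R w"
      using ev unfolding laguerre_eigenvalue_def by blast
    then have "laguerre_L (\<xi> \<circ> \<phi>) (k \<circ> \<phi>) u e $ i $ j = 0" for i j
      using assms(8) \<open>lam = 0\<close> unfolding L_isotropic_def by auto
    then have "laguerre_L (\<xi> \<circ> \<phi>) (k \<circ> \<phi>) u e = 0" by (simp add: vec_eq_iff)
    then show ?thesis using w by simp
  qed
  ultimately show ?thesis by blast
qed

end
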